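(* Let $d\in\mathbb{N}$ and $n\geq d+1$. Let $\mathscr{V}_{n+1,d}$ be the typical cell of the spherical Voronoi tessellation generated by $n+1$ independent uniformly distributed random points on the unit sphere $\mathbb{S}^d\subset\mathbb{R}^{d+1}$, and let $\tilde P_{n,d}^{d}$ be the beta' polytope in $\mathbb{R}^d$ generated by $n$ points with parameter $\beta=d$. Then $$\big(f_k(\mathscr{V}_{n+1,d})\big)_{k=0}^{d-1}\overset{d}{=}\big(f_{d-k-1}(\tilde P_{n,d}^{d})\big)_{k=0}^{d-1},$$ where $\overset{d}{=}$ denotes equality in distribution of random vectors.
   Context: Let $\mathbb{S}^d$ be the unit sphere in $\mathbb{R}^{d+1}$ centred at the origin, $\sigma_d$ the normalized (probability) spherical Lebesgue measure on it, $\rho$ the geodesic distance on $\mathbb{S}^d$, and $e=(1,0,\ldots,0)\in\mathbb{S}^d$ the north pole. Spherical Voronoi tessellation: for $m\in\mathbb{N}$ let $X_1,\ldots,X_m$ be independent random points on $\mathbb{S}^d$ with distribution $\sigma_d$. The Voronoi cells are $C_{i,m}:=\{z\in\mathbb{S}^d:\rho(X_i,z)\leq\rho(X_j,z)\text{ for all }j\in\{1,\ldots,m\}\}$, $i\in\{1,\ldots,m\}$. Typical cell: for every $v\in\mathbb{S}^d$ fix an orthogonal transformation $O_v:\mathbb{R}^{d+1}\to\mathbb{R}^{d+1}$ with $O_v v=e$ whose matrix entries are Borel functions of $v$. Let $N$ be uniformly distributed on $\{1,\ldots,m\}$, independent of $X_1,\ldots,X_m$. The typical cell is the random spherical polytope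 $\mathscr{V}_{m,d}:=O_{X_N}C_{N,m}$. Faces: a spherical polytope $P$ is the intersection of $\mathbb{S}^d$ with a polyhedral convex cone $C\subset\mathbb{R}^{d+1}$ (a finite intersection of closed half-spaces whose bounding hyperplanes contain the origin). The $k$-dimensional faces of $P$ are the intersections of the $(k+1)$-dimensional faces of $C$ with $\mathbb{S}^d$, $k\in\{0,\ldots,d\}$; $f_k(P)$ is their number. For a convex polytope $P\subset\mathbb{R}^d$, $f_k(P)$ denotes the number of its $k$-dimensional faces. Beta' polytope: for $\beta>d/2$ let $\tilde f_{d,\beta}(x)=\tilde c_{d,\beta}(1+\|x\|^2)^{-\beta}$, $x\in\mathbb{R}^d$, with $\tilde c_{d,\beta}=\frac{\Gamma(\beta)}{\pi^{d/2}\Gamma(\beta-d/2)}$, a probability density on $\mathbb{R}^d$. The beta' polytope $\tilde P_{n,d}^{\beta}$ is the convex hull of $n$ independent random points in $\mathbb{R}^d$ each with density $\tilde f_{d,\beta}$. *)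

theory Defs
  imports "HOL-Probability.Probability"
begin

text \<open>
  In the main theorem, \<open>\<real>\<^sup>d\<close> is \<open>real ^ 'd\<close> with \<open>d = CARD('d)\<close>, and \<open>\<real>\<^sup>d\<^sup>+\<^sup>1\<close> is \<open>real \<times> (real ^ 'd)\<close> with its
  Euclidean norm, so that \<open>(1, 0)\<close> is the north pole and \<open>sphere 0 1\<close> is the \<open>d\<close>-dimensional sphere.
  All notions below are defined for an arbitrary Euclidean space.
\<close>

subsection \<open>The sphere\<close>

definition geodesic_dist :: "'a::euclidean_space \<Rightarrow> 'a \<Rightarrow> real" where
  "geodesic_dist x y = arccos (x \<bullet> y)"

text \<open>
  The normalized spherical Lebesgue measure of a Borel subset \<open>A\<close> of the sphere is the proportion of
  the unit ball occupied by \<open>{r *\<^sub>R u | r u. 0 < r \<and> r \<le> 1 \<and> u \<in> A}\<close>, i.e. by the preimage of \<open>A\<close>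
  under the radial projection \<open>sgn x = x /\<^sub>R norm x\<close>.  Its underlying \<open>\<sigma>\<close>-algebra consists of the
  Borel subsets of the sphere.
\<close>

definition sphere_measure :: "'a::euclidean_space measure" where
  "sphere_measure =
     restrict_space (distr (uniform_measure lborel (cball 0 1)) borel sgn) (sphere 0 1)"

subsection \<open>Faces\<close>

definition num_faces :: "nat \<Rightarrow> 'a::euclidean_space set \<Rightarrow> nat" where
  "num_faces k P = card {F. F face_of P \<and> aff_dim F = int k}"

definition polyhedral_cone :: "'a::euclidean_space set \<Rightarrow> bool" where
  "polyhedral_cone C \<longleftrightarrow>
     (\<exists>H. finite H \<and> C = \<Inter>H \<and> (\<forall>h\<in>H. \<exists>a. a \<noteq> 0 \<and> h = {x. a \<bullet> x \<le> 0}))"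

text \<open>
  A polyhedral cone contains \<open>0\<close> and is closed under multiplication by positive scalars, so the cone
  \<open>C\<close> below is determined by the spherical polytope \<open>P\<close>.
\<close>

definition spherical_faces :: "nat \<Rightarrow> 'a::euclidean_space set \<Rightarrow> 'a set set" where
  "spherical_faces k P =
     {F \<inter> sphere 0 1 | F C. polyhedral_cone C \<and> P = C \<inter> sphere 0 1 \<and>
        F face_of C \<and> aff_dim F = int (k + 1)}"

definition num_spherical_faces :: "nat \<Rightarrow> 'a::euclidean_space set \<Rightarrow> nat" where
  "num_spherical_faces k P = card (spherical_faces k P)"

subsection \<open>Spherical Voronoi cells\<close>

definition voronoi_cell :: "nat \<Rightarrow> (nat \<Rightarrow> 'a::euclidean_space) \<Rightarrow> nat \<Rightarrow> 'a set" where
  "voronoi_cell m x i =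
     {z \<in> sphere 0 1. \<forall>j\<in>{1..m}. geodesic_dist (x i) z \<le> geodesic_dist (x j) z}"

text \<open>
  The typical cell is the random set \<open>\<lambda>\<omega>. typical_cell m R (\<lambda>i. X i \<omega>) (N \<omega>)\<close>, where \<open>R v\<close> is the
  chosen orthogonal transformation that takes \<open>v\<close> to the north pole.
\<close>

definition typical_cell ::
    "nat \<Rightarrow> ('a::euclidean_space \<Rightarrow> 'a \<Rightarrow> 'a) \<Rightarrow> (nat \<Rightarrow> 'a) \<Rightarrow> nat \<Rightarrow> 'a set" where
  "typical_cell m R x i = R (x i) ` voronoi_cell m x i"

subsection \<open>Beta' polytopes\<close>

definition beta_prime_density :: "real \<Rightarrow> 'a::euclidean_space \<Rightarrow> real" where
  "beta_prime_density \<beta> x =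
     Gamma \<beta> / (pi powr (DIM('a) / 2) * Gamma (\<beta> - DIM('a) / 2)) *
     (1 + (norm x)\<^sup>2) powr (- \<beta>)"

definition beta_prime_polytope :: "nat \<Rightarrow> (nat \<Rightarrow> 'a::euclidean_space) \<Rightarrow> 'a set" where
  "beta_prime_polytope n y = convex hull (y ` {1..n})"

subsection \<open>Equality in distribution\<close>

text \<open>
  Measurability is part of the notion, because \<^const>\<open>distr\<close> is only meaningful for measurable maps.
\<close>

definition eq_in_distribution ::
    "'s measure \<Rightarrow> ('s \<Rightarrow> 'c) \<Rightarrow> 't measure \<Rightarrow> ('t \<Rightarrow> 'c) \<Rightarrow> 'c measure \<Rightarrow> bool" where
  "eq_in_distribution M X M' Y S \<longleftrightarrow>
     X \<in> measurable M S \<and> Y \<in> measurable M' S \<and> distr M S X = distr M' S Y"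

end

theory Submission
  imports Defs
begin

text \<open>
  The Voronoi cell of \<open>x\<^sub>i\<close> is cut out of the sphere by the cone
  \<open>{z. \<forall>j \<noteq> i. (x\<^sub>j - x\<^sub>i) \<bullet> z \<le> 0}\<close>.  Faces of such a cone correspond to the sets \<open>J\<close> of constraints
  that can be active while all others are strict; the same sets \<open>J\<close>, taken for the vectors
  \<open>(1, y\<^sub>j)\<close>, describe the faces of the convex hull of the \<open>y\<^sub>j\<close>, with complementary dimensions.
  This combinatorial description makes no general position assumption and is unchanged when the
  vectors are rotated or multiplied by negative numbers.  After a rotation that takes \<open>x\<^sub>i\<close> to the
  north pole \<open>e\<close>, each \<open>x\<^sub>j - e\<close> is a negative multiple of \<open>(1, y\<^sub>j)\<close>, where \<open>y\<^sub>j\<close> is the stereographic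
  projection of \<open>x\<^sub>j\<close> up to sign, so both face vectors are the same function of the \<open>y\<^sub>j\<close>.

  Stereographic projection takes the uniform distribution to the beta' distribution with \<open>\<beta> = d\<close>:
  the volume of a cone over a set of directions \<open>(t, u)\<close> is computed in the coordinates
  \<open>s = \<parallel>(t, u)\<parallel> - t\<close> and \<open>y = - u / s\<close>, which takes only a substitution in one real variable and a
  scaling.
\<close>

subsection \<open>Faces of cones and polytopes\<close>

definition separable_by :: "'i set \<Rightarrow> 'i set \<Rightarrow> ('i \<Rightarrow> 'a::euclidean_space) \<Rightarrow> bool" where
  "separable_by J K w \<longleftrightarrow> (\<exists>z. (\<forall>j\<in>J. w j \<bullet> z = 0) \<and> (\<forall>j\<in>K. w j \<bullet> z < 0))"

text \<open>In the language of oriented matroids these are the zero sets, of rank \<open>r\<close>,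
  of the covectors of \<open>w\<close> without positive signs. They consist of indices and not of
  vectors, so that repeated or vanishing vectors need no separate treatment.\<close>

definition facial_sets :: "'i set \<Rightarrow> ('i \<Rightarrow> 'a::euclidean_space) \<Rightarrow> nat \<Rightarrow> 'i set set" where
  "facial_sets I w r = {J. J \<subseteq> I \<and> separable_by J (I - J) w \<and> dim (w ` J) = r}"

definition dual_cone :: "'i set \<Rightarrow> ('i \<Rightarrow> 'a::euclidean_space) \<Rightarrow> 'a set" where
  "dual_cone I w = {z. \<forall>j\<in>I. w j \<bullet> z \<le> 0}"

definition dual_face :: "'i set \<Rightarrow> ('i \<Rightarrow> 'a::euclidean_space) \<Rightarrow> 'i set \<Rightarrow> 'a set" where
  "dual_face I w J = {z \<in> dual_cone I w. \<forall>j\<in>J. w j \<bullet> z = 0}"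

lemma convex_dual_cone: "convex (dual_cone I w)"
proof -
  have "dual_cone I w = (\<Inter>j\<in>I. {z. w j \<bullet> z \<le> 0})"
    by (auto simp: dual_cone_def)
  then show ?thesis
    by (auto intro!: convex_INT convex_halfspace_le)
qed

lemma dual_face_face_of:
  assumes "J \<subseteq> I"
  shows "dual_face I w J face_of dual_cone I w"
\<comment> \<open>An intersection over the empty set would be \<open>UNIV\<close>, so the case in
  which the face is the whole cone is treated apart.\<close>
proof (cases "J = {}")
  case True
  then show ?thesis
    by (simp add: dual_face_def face_of_refl convex_dual_cone)
next
  case False
  have eq: "dual_face I w J = \<Inter>((\<lambda>j. dual_cone I w \<inter> {z. w j \<bullet> z = 0}) ` J)"
    using False by (auto simp: dual_face_def)
  show ?thesis
    unfolding eq
  proof (rule face_of_Inter)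
    fix T assume "T \<in> (\<lambda>j. dual_cone I w \<inter> {z. w j \<bullet> z = 0}) ` J"
    then obtain j where j: "j \<in> J" "T = dual_cone I w \<inter> {z. w j \<bullet> z = 0}"
      by auto
    show "T face_of dual_cone I w"
      unfolding j(2) using assms j(1)
      by (intro face_of_Int_supporting_hyperplane_le convex_dual_cone) (auto simp: dual_cone_def)
  qed (use False in auto)
qed

text \<open>Take \<open>J\<close> to be the constraints active at a relative interior point
  \<open>z\<close> of \<open>F\<close>. A segment from a point of \<open>F\<close> can be prolonged
  beyond \<open>z\<close> inside \<open>F\<close>, so the constraints in \<open>J\<close> vanish on
  all of \<open>F\<close>. A segment from a point of \<open>dual_face I w J\<close> can be prolonged
  beyond \<open>z\<close> inside the cone, so the face property puts that point into
  \<open>F\<close>.\<close>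

lemma face_of_dual_cone:
  assumes "finite I" "F face_of dual_cone I w" "F \<noteq> {}"
  obtains J where "J \<subseteq> I" "separable_by J (I - J) w" "F = dual_face I w J"
proof -
  have F: "F \<subseteq> dual_cone I w" "convex F"
    using assms(2) by (auto simp: face_of_def)
  then obtain z where z: "z \<in> rel_interior F"
    using rel_interior_eq_empty[of F] assms(3) by auto
  have zF: "z \<in> F"
    using z rel_interior_subset by blast
  define J where "J = {j \<in> I. w j \<bullet> z = 0}"
  have neg: "w j \<bullet> z < 0" if "j \<in> I - J" for j
    using that zF F(1) by (auto simp: J_def dual_cone_def less_le)
  have "F \<subseteq> dual_face I w J"
  proof
    fix x assume x: "x \<in> F"
    then obtain e where e: "e > 1" "(1 - e) *\<^sub>R x + e *\<^sub>R z \<in> F"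
      using convex_rel_interior_if2[OF F(2) z] hull_subset[of F affine] by blast
    have "w j \<bullet> x = 0" if "j \<in> J" for j
    proof -
      have "w j \<bullet> ((1 - e) *\<^sub>R x + e *\<^sub>R z) \<le> 0" "w j \<bullet> x \<le> 0" "w j \<bullet> z = 0"
        using that e(2) x F(1) by (auto simp: J_def dual_cone_def)
      then have "(1 - e) * (w j \<bullet> x) \<le> 0" "w j \<bullet> x \<le> 0"
        by (auto simp: inner_add_right)
      then show ?thesis
        using e(1) by (smt (verit) mult_neg_neg)
    qed
    then show "x \<in> dual_face I w J"
      using x F(1) by (auto simp: dual_face_def)
  qed
  moreover have "dual_face I w J \<subseteq> F"
  proof
    fix x assume x: "x \<in> dual_face I w J"
    show "x \<in> F"
    proof (cases "x = z")
      case False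
      \<comment> \<open>A strict inequality at \<open>z\<close> survives a small step beyond
        \<open>z\<close>, and finitely many of them allow a common step \<open>e\<close>.\<close>
      have "\<forall>\<^sub>F e in at_right 0. w j \<bullet> (z + e *\<^sub>R (z - x)) < 0" if "j \<in> I - J" for j
      proof -
        have "((\<lambda>e. w j \<bullet> (z + e *\<^sub>R (z - x))) \<longlongrightarrow> w j \<bullet> (z + 0 *\<^sub>R (z - x))) (at_right 0)"
          by (intro tendsto_intros)
        then show ?thesis
          using neg[OF that] by (intro order_tendstoD(2)) auto
      qed
      then have "\<forall>\<^sub>F e in at_right 0. \<forall>j\<in>I - J. w j \<bullet> (z + e *\<^sub>R (z - x)) < 0"
        using assms(1) by (intro eventually_ball_finite) auto
      then have "\<forall>\<^sub>F e in at_right (0::real). e > 0 \<and> (\<forall>j\<in>I - J. w j \<bullet> (z + e *\<^sub>R (z - x)) < 0)"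
        using eventually_at_right_less by eventually_elim auto
      then obtain e :: real where e: "e > 0" "\<forall>j\<in>I - J. w j \<bullet> (z + e *\<^sub>R (z - x)) < 0"
        using eventually_happens[of _ "at_right (0::real)"] by (auto simp: trivial_limit_at_right_real)
      define y where "y = z + e *\<^sub>R (z - x)"
      have y: "y \<in> dual_cone I w"
        unfolding dual_cone_def
      proof safe
        fix j assume "j \<in> I"
        show "w j \<bullet> y \<le> 0"
        proof (cases "j \<in> J")
          case True
          then show ?thesis
            using x by (simp add: y_def J_def dual_face_def inner_add_right inner_diff_right)
        qed (use e(2) \<open>j \<in> I\<close> in \<open>auto simp: y_def less_imp_le\<close>)
      qed
      have "x \<noteq> y"
      proof
        assume "x = y"
        then have "(1 + e) *\<^sub>R (z - x) = 0"
          by (simp add: y_def algebra_simps)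
        then show False
          using e False by auto
      qed
      moreover have "z = (1 - 1 / (1 + e)) *\<^sub>R x + (1 / (1 + e)) *\<^sub>R y"
      proof -
        have "(1 - s) *\<^sub>R x + s *\<^sub>R y = (1 - s * (1 + e)) *\<^sub>R x + (s * (1 + e)) *\<^sub>R z" for s
          by (simp add: y_def algebra_simps)
        from this[of "1 / (1 + e)"] show ?thesis
          using e by simp
      qed
      ultimately have "z \<in> open_segment x y"
        using e by (auto simp: in_segment intro!: exI[of _ "1 / (1 + e)"])
      then show ?thesis
        using assms(2) zF x y unfolding face_of_def dual_face_def by blast
    qed (use zF in simp)
  qed
  moreover have "separable_by J (I - J) w"
    unfolding separable_by_def using neg by (intro exI[of _ z]) (auto simp: J_def)
  ultimately show ?thesis
    using that[of J] by (auto simp: J_def)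
qed

text \<open>\<open>J\<close> is recovered as the set of constraints that vanish on the whole face:
  the witness \<open>z\<close> of separability lies in the face and is strictly negative for every
  other index.\<close>

lemma inj_on_dual_face: "inj_on (dual_face I w) {J. J \<subseteq> I \<and> separable_by J (I - J) w}"
proof (rule inj_on_inverseI)
  fix J assume "J \<in> {J. J \<subseteq> I \<and> separable_by J (I - J) w}"
  then obtain z where J: "J \<subseteq> I" and z: "\<forall>j\<in>J. w j \<bullet> z = 0" "\<forall>j\<in>I - J. w j \<bullet> z < 0"
    by (auto simp: separable_by_def)
  have "w j \<bullet> z \<le> 0" if "j \<in> I" for j
    using z that by (cases "j \<in> J") (simp_all add: less_imp_le)
  then have "z \<in> dual_face I w J"
    using z by (simp add: dual_face_def dual_cone_def)
  then have "j \<in> J" if "j \<in> I" "\<forall>x\<in>dual_face I w J. w j \<bullet> x = 0" for j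
    using that z(2) by (metis DiffI less_irrefl)
  then show "{j \<in> I. \<forall>x\<in>dual_face I w J. w j \<bullet> x = 0} = J"
    using J by (auto simp: dual_face_def)
qed

text \<open>The face lies between \<open>S \<inter> T\<close> and \<open>S\<close>, where
  \<open>S\<close> is the orthogonal complement of the active vectors and \<open>T\<close> is the
  open set given by the remaining strict inequalities. Separability says that
  \<open>S \<inter> T\<close> is nonempty, and a nonempty relatively open part of a subspace has
  full dimension.\<close>

lemma aff_dim_dual_face:
  fixes w :: "'i \<Rightarrow> 'a::euclidean_space"
  assumes "finite I" "J \<subseteq> I" "separable_by J (I - J) w"
  shows "aff_dim (dual_face I w J) = int (DIM('a)) - int (dim (w ` J))"
proof -
  define S where "S = {x. \<forall>j\<in>J. w j \<bullet> x = 0}"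
  define T where "T = (\<Inter>j\<in>I - J. {x. w j \<bullet> x < 0})"
  have S: "S = {y \<in> UNIV. \<forall>x\<in>span (w ` J). orthogonal x y}"
  proof -
    have "orthogonal x y" if "x \<in> span (w ` J)" "\<forall>j\<in>J. w j \<bullet> y = 0" for x y
      using that by (intro orthogonal_commute[THEN iffD1, OF orthogonal_to_span[of x "w ` J" y]])
        (auto simp: orthogonal_def inner_commute)
    then show ?thesis
      by (auto simp: S_def orthogonal_def) (metis imageI span_base)
  qed
  have "subspace S"
    unfolding S_def by (auto simp: subspace_def inner_add_right)
  moreover have "open T"
    unfolding T_def using assms(1) by (auto intro!: open_INT open_halfspace_lt)
  moreover have "S \<inter> T \<noteq> {}"
    using assms(3) by (auto simp: separable_by_def S_def T_def)
  ultimately have "aff_dim (S \<inter> T) = aff_dim S"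
    by (intro aff_dim_convex_Int_open subspace_imp_convex)
  moreover have "aff_dim (S \<inter> T) \<le> aff_dim (dual_face I w J)" "aff_dim (dual_face I w J) \<le> aff_dim S"
    by (intro aff_dim_subset;
        force simp: S_def T_def dual_face_def dual_cone_def intro: less_imp_le)+
  moreover have "dim S + dim (span (w ` J)) = DIM('a)"
    unfolding S by (subst dim_subspace_orthogonal_to_vectors) auto
  ultimately show ?thesis
    using aff_dim_subspace[OF \<open>subspace S\<close>] by simp
qed

text \<open>Zero vectors impose no constraint and are left out, because the definition of
  \<open>polyhedral_cone\<close> asks for nonzero normals.\<close>

lemma polyhedral_cone_dual_cone:
  assumes "finite I"
  shows "polyhedral_cone (dual_cone I w)"
  unfolding polyhedral_cone_def
proof (intro exI conjI)
  show "finite ((\<lambda>j. {x. w j \<bullet> x \<le> 0}) ` {j \<in> I. w j \<noteq> 0})"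
    using assms by simp
  show "dual_cone I w = \<Inter>((\<lambda>j. {x. w j \<bullet> x \<le> 0}) ` {j \<in> I. w j \<noteq> 0})"
    by (auto simp: dual_cone_def)
qed auto

lemma polyhedral_cone_inner:
  assumes "polyhedral_cone C"
  obtains A where "C = {x. \<forall>a\<in>A. a \<bullet> x \<le> 0}"
proof -
  from assms[unfolded polyhedral_cone_def] obtain H
    where "finite H \<and> C = \<Inter>H \<and> (\<forall>h\<in>H. \<exists>a. a \<noteq> 0 \<and> h = {x. a \<bullet> x \<le> 0})" ..
  note H = this[THEN conjunct2, THEN conjunct1] this[THEN conjunct2, THEN conjunct2]
  from bchoice[OF H(2)] obtain f where f: "\<forall>h\<in>H. f h \<noteq> 0 \<and> h = {x. f h \<bullet> x \<le> 0}" ..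
  have "x \<in> h \<longleftrightarrow> f h \<bullet> x \<le> 0" if "h \<in> H" for h x
    using eqset_imp_iff[OF bspec[OF f that, THEN conjunct2], of x] by simp
  then have "C = {x. \<forall>a\<in>f ` H. a \<bullet> x \<le> 0}"
    unfolding H(1) by auto
  then show ?thesis ..
qed

text \<open>Every nonzero point of a cone is a positive multiple of a point of the cone on the
  sphere. Consequently the cone in the definition of \<open>spherical_faces\<close> is determined by
  the polytope.\<close>

lemma polyhedral_cone_sphere_mono:
  fixes C C' :: "'a::euclidean_space set"
  assumes "polyhedral_cone C" "polyhedral_cone C'" "C \<inter> sphere 0 1 \<subseteq> C'"
  shows "C \<subseteq> C'"
proof
  obtain A A' where A: "C = {x. \<forall>a\<in>A. a \<bullet> x \<le> 0}" and A': "C' = {x. \<forall>a\<in>A'. a \<bullet> x \<le> 0}"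
    by (rule polyhedral_cone_inner[OF assms(1)], rule polyhedral_cone_inner[OF assms(2)]) (rule that)
  fix x assume x: "x \<in> C"
  show "x \<in> C'"
  proof (cases "x = 0")
    case True
    then show ?thesis
      by (simp add: A')
  next
    case False
    then have "(1 / norm x) *\<^sub>R x \<in> C \<inter> sphere 0 1"
      using x by (auto simp: A divide_nonpos_nonneg)
    then have "(1 / norm x) *\<^sub>R x \<in> C'"
      using assms(3) by blast
    then show ?thesis
      using False by (auto simp: A' divide_le_0_iff)
  qed
qed

text \<open>The same rescaling, for faces; it shows that different faces of the cone leave different
  traces on the sphere.\<close>

lemma dual_face_sphere_mono:
  assumes "dual_face I w J \<inter> sphere 0 1 \<subseteq> dual_face I w J'"
  shows "dual_face I w J \<subseteq> dual_face I w J'"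
proof
  have cone: "r *\<^sub>R x \<in> dual_face I w L" if "x \<in> dual_face I w L" "r \<ge> 0" for L r x
    using that by (auto simp: dual_face_def dual_cone_def mult_nonneg_nonpos)
  fix x assume x: "x \<in> dual_face I w J"
  show "x \<in> dual_face I w J'"
  proof (cases "x = 0")
    case True
    then show ?thesis
      by (auto simp: dual_face_def dual_cone_def)
  next
    case False
    then have "(1 / norm x) *\<^sub>R x \<in> dual_face I w J \<inter> sphere 0 1"
      using cone[OF x, of "1 / norm x"] by auto
    then show ?thesis
      using assms cone[of "(1 / norm x) *\<^sub>R x" J' "norm x"] False by auto
  qed
qed

text \<open>Faces of dimension \<open>k + 1\<close> of the cone come from the \<open>J\<close> whose
  vectors have the complementary rank. Neither the passage from \<open>J\<close> to the face nor the
  restriction to the sphere identifies any two of them.\<close>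

lemma num_spherical_faces_dual_cone:
  fixes w :: "'i \<Rightarrow> 'a::euclidean_space"
  assumes "finite I" "k < DIM('a)"
  shows "num_spherical_faces k (dual_cone I w \<inter> sphere 0 1) =
    card (facial_sets I w (DIM('a) - (k + 1)))"
proof -
  let ?C = "dual_cone I w" and ?S = "sphere (0::'a) 1" and ?r = "DIM('a) - (k + 1)"
  have "spherical_faces k (?C \<inter> ?S) = {F \<inter> ?S | F. F face_of ?C \<and> aff_dim F = int (k + 1)}"
  proof -
    have uniq: "C = ?C" if "polyhedral_cone C" "?C \<inter> ?S = C \<inter> ?S" for C
      using that polyhedral_cone_sphere_mono[OF that(1) polyhedral_cone_dual_cone[OF assms(1), of w]]
        polyhedral_cone_sphere_mono[OF polyhedral_cone_dual_cone[OF assms(1), of w] that(1)]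
      by auto
    show ?thesis
    proof (intro equalityI subsetI)
      fix G assume "G \<in> spherical_faces k (?C \<inter> ?S)"
      then obtain F C where G: "G = F \<inter> ?S" "polyhedral_cone C" "?C \<inter> ?S = C \<inter> ?S"
        "F face_of C" "aff_dim F = int (k + 1)"
        unfolding spherical_faces_def by blast
      then show "G \<in> {F \<inter> ?S | F. F face_of ?C \<and> aff_dim F = int (k + 1)}"
        using uniq[OF G(2,3)] by blast
    next
      fix G assume "G \<in> {F \<inter> ?S | F. F face_of ?C \<and> aff_dim F = int (k + 1)}"
      then show "G \<in> spherical_faces k (?C \<inter> ?S)"
        unfolding spherical_faces_def using polyhedral_cone_dual_cone[OF assms(1), of w] by blast
    qed
  qed
  also have "\<dots> = (\<lambda>J. dual_face I w J \<inter> ?S) ` facial_sets I w ?r"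
  proof (intro equalityI subsetI)
    fix G assume "G \<in> {F \<inter> ?S | F. F face_of ?C \<and> aff_dim F = int (k + 1)}"
    then obtain F where F: "G = F \<inter> ?S" "F face_of ?C" "aff_dim F = int (k + 1)"
      by auto
    \<comment> \<open>The empty face has affine dimension -1.\<close>
    then have "F \<noteq> {}"
      by auto
    then obtain J where J: "J \<subseteq> I" "separable_by J (I - J) w" "F = dual_face I w J"
      using face_of_dual_cone[OF assms(1) F(2)] by metis
    then have "J \<in> facial_sets I w ?r"
      using aff_dim_dual_face[OF assms(1) J(1,2)] F(3) by (auto simp: facial_sets_def)
    then show "G \<in> (\<lambda>J. dual_face I w J \<inter> ?S) ` facial_sets I w ?r"
      using F(1) J(3) by auto
  next
    fix G assume "G \<in> (\<lambda>J. dual_face I w J \<inter> ?S) ` facial_sets I w ?r"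
    then obtain J where J: "J \<subseteq> I" "separable_by J (I - J) w" "dim (w ` J) = ?r"
      "G = dual_face I w J \<inter> ?S"
      by (auto simp: facial_sets_def)
    moreover have "aff_dim (dual_face I w J) = int (k + 1)"
      using aff_dim_dual_face[OF assms(1) J(1,2)] J(3) assms(2) by (simp add: of_nat_diff)
    ultimately show "G \<in> {F \<inter> ?S | F. F face_of ?C \<and> aff_dim F = int (k + 1)}"
      using dual_face_face_of[OF J(1), of w] by blast
  qed
  finally have "spherical_faces k (?C \<inter> ?S) = (\<lambda>J. dual_face I w J \<inter> ?S) ` facial_sets I w ?r" .
  moreover have "inj_on (\<lambda>J. dual_face I w J \<inter> ?S) (facial_sets I w ?r)"
  proof (rule inj_onI)
    fix J J' assume J: "J \<in> facial_sets I w ?r" "J' \<in> facial_sets I w ?r"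
      and eq: "dual_face I w J \<inter> ?S = dual_face I w J' \<inter> ?S"
    have "dual_face I w J = dual_face I w J'"
      using eq by (intro equalityI dual_face_sphere_mono) auto
    then show "J = J'"
      using J inj_onD[OF inj_on_dual_face[of I w]] by (auto simp: facial_sets_def)
  qed
  ultimately show ?thesis
    by (simp add: num_spherical_faces_def card_image)
qed

section \<open>Faces of convex hulls by homogenization\<close>

text \<open>A linear combination of lifted points \<open>(1, v)\<close> that equals
  \<open>(1, a)\<close> has coefficients with sum 1, so it is an affine combination of the
  \<open>v\<close>. Hence a new point raises either both sides or neither.\<close>

lemma aff_dim_eq_dim_Pair:
  fixes S :: "'a::euclidean_space set"
  assumes "finite S"
  shows "int (dim (Pair (1::real) ` S)) = aff_dim S + 1"
  using assms
proof (induction S rule: finite_induct)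
  case empty
  then show ?case by simp
next
  case (insert a S)
  have "(1, a) \<in> span (Pair (1::real) ` S) \<longleftrightarrow> a \<in> affine hull S"
  proof -
    have *: "(1, a) = (\<Sum>v\<in>S. u v *\<^sub>R (1::real, v)) \<longleftrightarrow> sum u S = 1 \<and> (\<Sum>v\<in>S. u v *\<^sub>R v) = a" for u
      by (auto simp: prod_eq_iff fst_sum snd_sum)
    have "span (Pair (1::real) ` S) = range (\<lambda>u. \<Sum>v\<in>S. u v *\<^sub>R (1::real, v))"
    proof -
      have "range (\<lambda>u. \<Sum>v\<in>Pair (1::real) ` S. u v *\<^sub>R v) = range (\<lambda>u. \<Sum>v\<in>S. u v *\<^sub>R (1::real, v))"
      proof (intro equalityI subsetI)
        fix x assume "x \<in> range (\<lambda>u. \<Sum>v\<in>Pair (1::real) ` S. u v *\<^sub>R v)"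
        then show "x \<in> range (\<lambda>u. \<Sum>v\<in>S. u v *\<^sub>R (1::real, v))"
          by (auto simp: sum.reindex inj_on_def intro: rangeI[of _ "\<lambda>v. _ (1, v)"])
      next
        fix x assume "x \<in> range (\<lambda>u. \<Sum>v\<in>S. u v *\<^sub>R (1::real, v))"
        then obtain u where "x = (\<Sum>v\<in>S. u v *\<^sub>R (1::real, v))"
          by auto
        then have "x = (\<Sum>v\<in>Pair (1::real) ` S. u (snd v) *\<^sub>R v)"
          by (simp add: sum.reindex inj_on_def)
        then show "x \<in> range (\<lambda>u. \<Sum>v\<in>Pair (1::real) ` S. u v *\<^sub>R v)"
          by (intro range_eqI[of _ _ "\<lambda>v. u (snd v)"])
      qed
      then show ?thesis
        using insert.hyps by (simp add: span_finite)
    qed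
    then show ?thesis
      by (simp only: affine_hull_finite[OF insert.hyps(1)] * image_iff) simp
  qed
  then show ?case
    using insert.IH by (simp add: dim_insert aff_dim_insert)
qed

text \<open>For \<open>z = (- b, a)\<close> separability says that the hyperplane
  \<open>a \<bullet> x = b\<close> supports the polytope and contains exactly the points
  \<open>y j\<close> with \<open>j \<in> J\<close>. All faces of a polytope are exposed, so each of
  them arises in this way. The rank is \<open>r + 1\<close> because of the additional
  coordinate.\<close>

lemma num_faces_convex_hull:
  fixes y :: "'i \<Rightarrow> 'a::euclidean_space"
  assumes "finite I"
  shows "num_faces r (convex hull (y ` I)) = card (facial_sets I (\<lambda>j. (1::real, y j)) (r + 1))"
proof -
  let ?P = "convex hull (y ` I)" and ?w = "\<lambda>j. (1::real, y j)"
  have dim_w: "int (dim (?w ` J)) = aff_dim (convex hull (y ` J)) + 1" if "J \<subseteq> I" for J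
  proof -
    have "finite (y ` J)"
      using assms that by (meson finite_imageI finite_subset)
    then show ?thesis
      using aff_dim_eq_dim_Pair[of "y ` J"] by (simp add: image_image aff_dim_convex_hull)
  qed
  \<comment> \<open>A supporting hyperplane cuts out a face, and a face of the hull of a finite set
    is the hull of some of its points, here necessarily of points on the hyperplane.\<close>
  have hull_face: "?P \<inter> {x. a \<bullet> x = b} face_of ?P \<and>
      ?P \<inter> {x. a \<bullet> x = b} = convex hull (y ` {j \<in> I. a \<bullet> y j = b})"
    if le: "\<forall>j\<in>I. a \<bullet> y j \<le> b" for a b
  proof -
    have "?P \<subseteq> {x. a \<bullet> x \<le> b}"
      using le by (intro hull_minimal) (auto simp: convex_halfspace_le)
    then have face: "?P \<inter> {x. a \<bullet> x = b} face_of ?P"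
      by (intro face_of_Int_supporting_hyperplane_le) auto
    obtain S where S: "S \<subseteq> y ` I" "?P \<inter> {x. a \<bullet> x = b} = convex hull S"
      by (rule face_of_convex_hull_subset[OF _ face]) (simp_all add: assms finite_imp_compact)
    have "S \<subseteq> y ` {j \<in> I. a \<bullet> y j = b}"
      using S hull_subset[of S convex] by fastforce
    then have "convex hull S \<subseteq> convex hull (y ` {j \<in> I. a \<bullet> y j = b})"
      by (rule hull_mono)
    moreover have "convex hull (y ` {j \<in> I. a \<bullet> y j = b}) \<subseteq> ?P \<inter> {x. a \<bullet> x = b}"
      by (intro hull_minimal) (auto simp: convex_Int convex_hyperplane intro: hull_inc)
    ultimately show ?thesis
      using face S(2) by auto
  qed
  have sep: "\<exists>a b. (\<forall>j\<in>J. a \<bullet> y j = b) \<and> (\<forall>j\<in>I - J. a \<bullet> y j < b)"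
    if "separable_by J (I - J) ?w" for J
  proof -
    obtain z :: "real \<times> 'a" where z: "\<forall>j\<in>J. ?w j \<bullet> z = 0" "\<forall>j\<in>I - J. ?w j \<bullet> z < 0"
      using \<open>separable_by J (I - J) ?w\<close> by (auto simp: separable_by_def)
    show ?thesis
      using z by (intro exI[of _ "snd z"] exI[of _ "- fst z"])
        (force simp: inner_prod_def inner_commute)
  qed
  have "{F. F face_of ?P \<and> aff_dim F = int r} =
      (\<lambda>J. convex hull (y ` J)) ` facial_sets I ?w (r + 1)"
  proof (intro equalityI subsetI)
    fix F assume "F \<in> {F. F face_of ?P \<and> aff_dim F = int r}"
    then have F: "F face_of ?P" "aff_dim F = int r"
      by auto
    then have "F exposed_face_of ?P"
      using assms by (simp add: exposed_face_of_polyhedron polyhedron_convex_hull)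
    then obtain a b where ab: "?P \<subseteq> {x. a \<bullet> x \<le> b}" "F = ?P \<inter> {x. a \<bullet> x = b}"
      by (auto simp: exposed_face_of_def)
    define J where "J = {j \<in> I. a \<bullet> y j = b}"
    have le: "\<forall>j\<in>I. a \<bullet> y j \<le> b"
      using ab(1) by (meson hull_inc image_eqI mem_Collect_eq subsetD)
    then have eq: "F = convex hull (y ` J)"
      using hull_face ab(2) by (auto simp: J_def)
    moreover have "separable_by J (I - J) ?w"
      unfolding separable_by_def using le
      by (intro exI[of _ "(- b, a)"]) (auto simp: J_def inner_commute less_le)
    moreover have "dim (?w ` J) = r + 1"
      using dim_w[of J] F(2) eq by (auto simp: J_def)
    ultimately show "F \<in> (\<lambda>J. convex hull (y ` J)) ` facial_sets I ?w (r + 1)"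
      by (auto simp: facial_sets_def J_def)
  next
    fix F assume "F \<in> (\<lambda>J. convex hull (y ` J)) ` facial_sets I ?w (r + 1)"
    then obtain J where J: "F = convex hull (y ` J)" "J \<subseteq> I" "separable_by J (I - J) ?w"
      "dim (?w ` J) = r + 1"
      by (auto simp: facial_sets_def)
    obtain a b where ab: "\<forall>j\<in>J. a \<bullet> y j = b" "\<forall>j\<in>I - J. a \<bullet> y j < b"
      using sep[OF J(3)] by blast
    then have "J = {j \<in> I. a \<bullet> y j = b}"
      using J(2) by force
    then have "F face_of ?P"
      using hull_face[of a b] ab J(1) by (metis Diff_iff less_imp_le order_refl)
    moreover have "aff_dim F = int r"
      using dim_w[OF J(2)] J(1,4) by simp
    ultimately show "F \<in> {F. F face_of ?P \<and> aff_dim F = int r}"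
      by auto
  qed
  \<comment> \<open>\<open>J\<close> is recovered as the set of indices whose points lie in the
    face.\<close>
  moreover have "inj_on (\<lambda>J. convex hull (y ` J)) (facial_sets I ?w (r + 1))"
  proof (rule inj_on_inverseI)
    fix J assume "J \<in> facial_sets I ?w (r + 1)"
    then have J: "J \<subseteq> I" "separable_by J (I - J) ?w"
      by (auto simp: facial_sets_def)
    obtain a b where ab: "\<forall>j\<in>J. a \<bullet> y j = b" "\<forall>j\<in>I - J. a \<bullet> y j < b"
      using sep[OF J(2)] by blast
    have "convex hull (y ` J) \<subseteq> {x. a \<bullet> x = b}"
      using ab by (intro hull_minimal) (auto simp: convex_hyperplane)
    then show "{j \<in> I. y j \<in> convex hull (y ` J)} = J"
      using J(1) ab(2) by (fastforce intro: hull_inc)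
  qed
  ultimately show ?thesis
    by (simp add: num_faces_def card_image)
qed

section \<open>Invariance of facial sets\<close>

lemma facial_sets_cong:
  assumes "\<And>j. j \<in> I \<Longrightarrow> w j = w' j"
  shows "facial_sets I w r = facial_sets I w' r"
proof -
  have "separable_by J (I - J) w = separable_by J (I - J) w'" "w ` J = w' ` J" if "J \<subseteq> I" for J
    using that assms by (auto simp: separable_by_def subset_iff intro!: image_cong)
  then show ?thesis
    by (auto simp: facial_sets_def)
qed

text \<open>Negative factors reverse all strict signs, and replacing the witness \<open>z\<close> by
  \<open>- z\<close> reverses them back, even if the factors vary with the index. The span of each
  subfamily stays the same.\<close>

lemma facial_sets_scaleR_neg:
  fixes w :: "'i \<Rightarrow> 'a::euclidean_space"
  assumes c: "\<And>j. j \<in> I \<Longrightarrow> c j < 0"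
  shows "facial_sets I (\<lambda>j. c j *\<^sub>R w j) r = facial_sets I w r"
proof -
  have "separable_by J (I - J) (\<lambda>j. c j *\<^sub>R w j) \<longleftrightarrow> separable_by J (I - J) w" if J: "J \<subseteq> I" for J
  proof
    assume "separable_by J (I - J) (\<lambda>j. c j *\<^sub>R w j)"
    then obtain z where z: "\<forall>j\<in>J. c j * (w j \<bullet> z) = 0" "\<forall>j\<in>I - J. c j * (w j \<bullet> z) < 0"
      by (auto simp: separable_by_def)
    have "w j \<bullet> z = 0" if "j \<in> J" for j
      using z(1) c[of j] J that by force
    moreover have "0 < w j \<bullet> z" if "j \<in> I - J" for j
      using bspec[OF z(2) that] c[of j] that by (auto simp: mult_less_0_iff)
    ultimately show "separable_by J (I - J) w"
      unfolding separable_by_def by (intro exI[of _ "- z"]) auto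
  next
    assume "separable_by J (I - J) w"
    then obtain z where z: "\<forall>j\<in>J. w j \<bullet> z = 0" "\<forall>j\<in>I - J. w j \<bullet> z < 0"
      by (auto simp: separable_by_def)
    then show "separable_by J (I - J) (\<lambda>j. c j *\<^sub>R w j)"
      unfolding separable_by_def using c by (intro exI[of _ "- z"]) (auto simp: mult_neg_neg)
  qed
  moreover have "dim ((\<lambda>j. c j *\<^sub>R w j) ` J) = dim (w ` J)" if J: "J \<subseteq> I" for J
  proof -
    have "w j \<in> span ((\<lambda>j. c j *\<^sub>R w j) ` J)" if "j \<in> J" for j
    proof -
      have "inverse (c j) *\<^sub>R (c j *\<^sub>R w j) \<in> span ((\<lambda>j. c j *\<^sub>R w j) ` J)"
        using that by (intro span_scale span_base) auto
      then show ?thesis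
        using c[of j] J that by auto
    qed
    moreover have "c j *\<^sub>R w j \<in> span (w ` J)" if "j \<in> J" for j
      using that by (intro span_scale span_base) auto
    ultimately have "span ((\<lambda>j. c j *\<^sub>R w j) ` J) = span (w ` J)"
      unfolding span_eq by auto
    then show ?thesis
      by (metis dim_span)
  qed
  ultimately show ?thesis
    by (auto simp: facial_sets_def)
qed

lemma facial_sets_orthogonal_transformation:
  fixes w :: "'i \<Rightarrow> 'a::euclidean_space" and T :: "'a \<Rightarrow> 'a"
  assumes T: "orthogonal_transformation T"
  shows "facial_sets I (\<lambda>j. T (w j)) r = facial_sets I w r"
proof -
  have inner: "T x \<bullet> T y = x \<bullet> y" for x y
    using T by (simp add: orthogonal_transformation_def)
  have "separable_by J K (\<lambda>j. T (w j)) \<longleftrightarrow> separable_by J K w" for J K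
  proof
    assume "separable_by J K (\<lambda>j. T (w j))"
    then obtain z where z: "\<forall>j\<in>J. T (w j) \<bullet> z = 0" "\<forall>j\<in>K. T (w j) \<bullet> z < 0"
      by (auto simp: separable_by_def)
    obtain u where "z = T u"
      using surjD[OF orthogonal_transformation_surj[OF T]] by blast
    then show "separable_by J K w"
      unfolding separable_by_def using z by (intro exI[of _ u]) (simp add: inner)
  next
    assume "separable_by J K w"
    then obtain z where "\<forall>j\<in>J. w j \<bullet> z = 0" "\<forall>j\<in>K. w j \<bullet> z < 0"
      by (auto simp: separable_by_def)
    then show "separable_by J K (\<lambda>j. T (w j))"
      unfolding separable_by_def by (intro exI[of _ "T z"]) (simp add: inner)
  qed
  moreover have "dim ((\<lambda>j. T (w j)) ` J) = dim (w ` J)" for J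
    using dim_image_eq[of T "w ` J"] orthogonal_transformation_linear[OF T]
      inj_on_subset[OF orthogonal_transformation_inj[OF T] subset_UNIV]
    by (simp add: image_image)
  ultimately show ?thesis
    by (auto simp: facial_sets_def)
qed

lemma card_facial_sets_reindex:
  assumes "bij_betw f I I'"
  shows "card (facial_sets I (\<lambda>i. w (f i)) r) = card (facial_sets I' w r)"
proof -
  have inj: "inj_on f I" and I': "I' = f ` I"
    using assms by (auto simp: bij_betw_def)
  have iff: "f ` J \<in> facial_sets I' w r \<longleftrightarrow> J \<in> facial_sets I (\<lambda>i. w (f i)) r" if J: "J \<subseteq> I" for J
  proof -
    have "I' - f ` J = f ` (I - J)"
      unfolding I' using inj J by (simp add: inj_on_image_set_diff)
    then show ?thesis
      using J by (auto simp: facial_sets_def separable_by_def image_image I')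
  qed
  have "facial_sets I' w r = (`) f ` facial_sets I (\<lambda>i. w (f i)) r"
  proof (intro equalityI subsetI)
    fix L assume L: "L \<in> facial_sets I' w r"
    then obtain J where "J \<subseteq> I" "L = f ` J"
      unfolding facial_sets_def I' by (auto simp: subset_image_iff)
    then show "L \<in> (`) f ` facial_sets I (\<lambda>i. w (f i)) r"
      using L iff by auto
  next
    fix L assume "L \<in> (`) f ` facial_sets I (\<lambda>i. w (f i)) r"
    then show "L \<in> facial_sets I' w r"
      using iff by (auto simp: facial_sets_def)
  qed
  moreover have "inj_on ((`) f) (facial_sets I (\<lambda>i. w (f i)) r)"
    using inj_on_image_eq_iff[OF inj] by (intro inj_onI) (auto simp: facial_sets_def)
  ultimately show ?thesis
    by (simp add: card_image)
qed

subsection \<open>Measurability of face numbers\<close>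

text \<open>The uncountable quantifier is replaced by one over a countable dense
  \<open>D \<subseteq> K\<close>. By continuity, a value at most 0 forces values below every
  \<open>inverse (Suc n)\<close> on \<open>D\<close>; conversely, such values force the minimum,
  attained on the compact \<open>K\<close>, to be at most 0.\<close>

lemma sets_Collect_ex_compact:
  fixes f :: "'b::euclidean_space \<Rightarrow> 's \<Rightarrow> real"
  assumes K: "compact K"
    and meas: "\<And>z. f z \<in> borel_measurable M"
    and cont: "\<And>\<omega>. \<omega> \<in> space M \<Longrightarrow> continuous_on K (\<lambda>z. f z \<omega>)"
  shows "{\<omega> \<in> space M. \<exists>z\<in>K. f z \<omega> \<le> 0} \<in> sets M"
proof -
  obtain D where D: "countable D" "D \<subseteq> K" "K \<subseteq> closure D"
    using separable by blast
  have eq: "(\<exists>z\<in>K. f z \<omega> \<le> 0) \<longleftrightarrow> (\<forall>n. \<exists>q\<in>D. f q \<omega> < inverse (Suc n))" if \<omega>: "\<omega> \<in> space M" for \<omega>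
  proof
    assume "\<exists>z\<in>K. f z \<omega> \<le> 0"
    then obtain z where z: "z \<in> K" "f z \<omega> \<le> 0"
      by auto
    show "\<forall>n. \<exists>q\<in>D. f q \<omega> < inverse (Suc n)"
    proof
      fix n
      obtain d where d: "d > 0" "\<And>y. y \<in> K \<Longrightarrow> dist y z < d \<Longrightarrow> dist (f y \<omega>) (f z \<omega>) < inverse (Suc n)"
        using cont[OF \<omega>] z(1) unfolding continuous_on_iff by (metis inverse_positive_iff_positive of_nat_0_less_iff zero_less_Suc)
      obtain q where "q \<in> D" "dist q z < d"
        using D(3) z(1) d(1) by (meson closure_approachable subsetD)
      then show "\<exists>q\<in>D. f q \<omega> < inverse (Suc n)"
        using d(2)[of q] D(2) z(2) by (intro bexI[of _ q]) (auto simp: dist_real_def)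
    qed
  next
    assume *: "\<forall>n. \<exists>q\<in>D. f q \<omega> < inverse (Suc n)"
    then have "K \<noteq> {}"
      using D(2) by auto
    then obtain z where z: "z \<in> K" "\<And>y. y \<in> K \<Longrightarrow> f z \<omega> \<le> f y \<omega>"
      using continuous_attains_inf[OF K _ cont[OF \<omega>]] by auto
    have "f z \<omega> \<le> 0"
    proof (rule ccontr)
      assume "\<not> f z \<omega> \<le> 0"
      then obtain n where "inverse (Suc n) < f z \<omega>"
        using reals_Archimedean[of "f z \<omega>"] by (auto simp del: of_nat_Suc)
      then show False
        using * z(2) D(2) by (meson less_asym less_le_trans subsetD)
    qed
    then show "\<exists>z\<in>K. f z \<omega> \<le> 0"
      using z(1) by auto
  qed
  have "{\<omega> \<in> space M. \<forall>n. \<exists>q\<in>D. f q \<omega> < inverse (Suc n)} \<in> sets M"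
    using D(1) meas
    by (intro sets.sets_Collect_countable_All sets.sets_Collect_countable_Bex) measurable
  then show ?thesis
    using eq by (simp cong: conj_cong)
qed

text \<open>Witnesses range over an unbounded set and satisfy strict inequalities, which compactness
  does not handle. Scaling a witness turns \<open>< 0\<close> into \<open>\<le> - 1\<close> for
  finitely many indices, so separability becomes the vanishing of a continuous penalty somewhere in
  one of countably many balls.\<close>

lemma separable_by_iff_cball:
  assumes "finite J" "finite K"
  shows "separable_by J K w \<longleftrightarrow>
    (\<exists>m::nat. \<exists>z\<in>cball 0 (real m). (\<Sum>j\<in>J. \<bar>w j \<bullet> z\<bar>) + (\<Sum>j\<in>K. max 0 (w j \<bullet> z + 1)) \<le> 0)"
    (is "_ \<longleftrightarrow> ?rhs")
proof
  assume "separable_by J K w"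
  then obtain z where z: "\<forall>j\<in>J. w j \<bullet> z = 0" "\<forall>j\<in>K. w j \<bullet> z < 0"
    by (auto simp: separable_by_def)
  \<comment> \<open>\<open>c\<close> is at least each single summand, so scaling by \<open>c\<close>
    brings every \<open>w j \<bullet> z\<close> with \<open>j \<in> K\<close> down to at most
    -1.\<close>
  define c where "c = (\<Sum>j\<in>K. 1 / (- (w j \<bullet> z)))"
  have c: "w j \<bullet> (c *\<^sub>R z) \<le> - 1" if "j \<in> K" for j
  proof -
    have neg: "w j \<bullet> z < 0"
      using z(2) that by auto
    have "1 / (- (w j \<bullet> z)) \<le> c"
      unfolding c_def using z(2) assms(2) that
      by (intro member_le_sum[of j K "\<lambda>j. 1 / (- (w j \<bullet> z))"]) (auto simp: divide_nonneg_neg less_imp_le)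
    then have "1 / (- (w j \<bullet> z)) * (- (w j \<bullet> z)) \<le> c * (- (w j \<bullet> z))"
      using neg by (intro mult_right_mono) auto
    then show ?thesis
      using neg by simp
  qed
  obtain m :: nat where m: "norm (c *\<^sub>R z) \<le> real m"
    using real_arch_simple by blast
  have "(\<Sum>j\<in>J. \<bar>w j \<bullet> (c *\<^sub>R z)\<bar>) = 0"
    using z(1) by simp
  moreover have "max 0 (w j \<bullet> (c *\<^sub>R z) + 1) = 0" if "j \<in> K" for j
    using c[OF that] by simp
  then have "(\<Sum>j\<in>K. max 0 (w j \<bullet> (c *\<^sub>R z) + 1)) = 0"
    by (intro sum.neutral) blast
  ultimately show ?rhs
    using m by (intro exI[of _ m] bexI[of _ "c *\<^sub>R z"]) auto
next
  assume ?rhs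
  then obtain z where z: "(\<Sum>j\<in>J. \<bar>w j \<bullet> z\<bar>) + (\<Sum>j\<in>K. max 0 (w j \<bullet> z + 1)) \<le> 0"
    by auto
  have "(\<Sum>j\<in>J. \<bar>w j \<bullet> z\<bar>) \<ge> 0" "(\<Sum>j\<in>K. max 0 (w j \<bullet> z + 1)) \<ge> 0"
    by (auto intro: sum_nonneg)
  then have "(\<Sum>j\<in>J. \<bar>w j \<bullet> z\<bar>) = 0" "(\<Sum>j\<in>K. max 0 (w j \<bullet> z + 1)) = 0"
    using z by linarith+
  then have "\<forall>j\<in>J. w j \<bullet> z = 0" "\<forall>j\<in>K. max 0 (w j \<bullet> z + 1) = 0"
    using assms by (auto simp: sum_nonneg_eq_0_iff)
  then show "separable_by J K w"
    unfolding separable_by_def by (intro exI[of _ z]) (auto simp: max_def split: if_splits)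
qed

lemma sets_Collect_separable_by:
  fixes w :: "'i \<Rightarrow> 's \<Rightarrow> 'a::euclidean_space"
  assumes "finite J" "finite K"
    and [measurable]: "\<And>j. j \<in> J \<union> K \<Longrightarrow> w j \<in> borel_measurable M"
  shows "{\<omega> \<in> space M. separable_by J K (\<lambda>j. w j \<omega>)} \<in> sets M"
proof -
  define f where
    "f z \<omega> = (\<Sum>j\<in>J. \<bar>w j \<omega> \<bullet> z\<bar>) + (\<Sum>j\<in>K. max 0 (w j \<omega> \<bullet> z + 1))" for z \<omega>
  have "f z \<in> borel_measurable M" for z
    unfolding f_def by measurable
  moreover have "continuous_on S (\<lambda>z. f z \<omega>)" for S \<omega>
    unfolding f_def by (intro continuous_intros)
  ultimately have "{\<omega> \<in> space M. \<exists>z\<in>cball 0 (real m). f z \<omega> \<le> 0} \<in> sets M" for m :: nat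
    by (intro sets_Collect_ex_compact compact_cball)
  then have "{\<omega> \<in> space M. \<exists>m::nat. \<exists>z\<in>cball 0 (real m). f z \<omega> \<le> 0} \<in> sets M"
    by (intro sets.sets_Collect_countable_Ex)
  then show ?thesis
    unfolding separable_by_iff_cball[OF assms(1,2)] f_def .
qed

text \<open>The negative of the component of \<open>a\<close> orthogonal to the span is a witness.
  The right-hand side is an instance of \<open>separable_by\<close>, so
  \<open>sets_Collect_separable_by\<close> applies to membership in a span.\<close>

lemma not_in_span_iff:
  fixes a :: "'a::euclidean_space"
  shows "a \<notin> span S \<longleftrightarrow> (\<exists>z. (\<forall>x\<in>S. x \<bullet> z = 0) \<and> a \<bullet> z < 0)"
proof
  assume a: "a \<notin> span S"
  obtain y z where yz: "y \<in> span S" "\<And>x. x \<in> span S \<Longrightarrow> orthogonal z x" "a = y + z"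
    using orthogonal_subspace_decomp_exists[of S a] by metis
  then have "z \<noteq> 0"
    using a by auto
  then show "\<exists>z. (\<forall>x\<in>S. x \<bullet> z = 0) \<and> a \<bullet> z < 0"
    using yz by (intro exI[of _ "- z"])
      (auto simp: orthogonal_def inner_commute inner_add_right span_base)
next
  assume "\<exists>z. (\<forall>x\<in>S. x \<bullet> z = 0) \<and> a \<bullet> z < 0"
  then obtain z where z: "\<forall>x\<in>S. x \<bullet> z = 0" "a \<bullet> z < 0"
    by auto
  show "a \<notin> span S"
  proof
    assume "a \<in> span S"
    then have "orthogonal z a"
      by (rule orthogonal_to_span) (use z(1) in \<open>simp add: orthogonal_def inner_commute\<close>)
    then show False
      using z(2) by (simp add: orthogonal_def inner_commute)
  qed
qed

text \<open>When vectors are added one at a time, the rank grows by 1 exactly if the new vector is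
  outside the span of the earlier ones, which is a measurable event by separability.\<close>

lemma measurable_dim_image:
  fixes w :: "'i \<Rightarrow> 's \<Rightarrow> 'a::euclidean_space"
  assumes "finite J" "\<And>j. j \<in> J \<Longrightarrow> w j \<in> borel_measurable M"
  shows "(\<lambda>\<omega>. dim ((\<lambda>j. w j \<omega>) ` J)) \<in> measurable M (count_space UNIV)"
  using assms
proof (induction J rule: finite_induct)
  case empty
  then show ?case by simp
next
  case (insert a J)
  have [measurable]: "{\<omega> \<in> space M. separable_by J {a} (\<lambda>j. w j \<omega>)} \<in> sets M"
    using insert by (intro sets_Collect_separable_by) auto
  have [measurable]: "(\<lambda>\<omega>. dim ((\<lambda>j. w j \<omega>) ` J)) \<in> measurable M (count_space UNIV)"
    using insert by auto
  have eq: "dim ((\<lambda>j. w j \<omega>) ` insert a J) =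
      (if separable_by J {a} (\<lambda>j. w j \<omega>) then dim ((\<lambda>j. w j \<omega>) ` J) + 1 else dim ((\<lambda>j. w j \<omega>) ` J))"
    for \<omega>
    using not_in_span_iff[of "w a \<omega>" "(\<lambda>j. w j \<omega>) ` J"] by (auto simp: dim_insert separable_by_def)
  show ?case
    unfolding eq by measurable
qed

lemma measurable_card_facial_sets:
  fixes w :: "'i \<Rightarrow> 's \<Rightarrow> 'a::euclidean_space"
  assumes "finite I" "\<And>j. j \<in> I \<Longrightarrow> w j \<in> borel_measurable M"
  shows "(\<lambda>\<omega>. card (facial_sets I (\<lambda>j. w j \<omega>) r)) \<in> measurable M (count_space UNIV)"
proof -
  define P where "P J \<omega> \<longleftrightarrow> separable_by J (I - J) (\<lambda>j. w j \<omega>) \<and> dim ((\<lambda>j. w j \<omega>) ` J) = r" for J \<omega>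
  have P: "{\<omega> \<in> space M. P J \<omega>} \<in> sets M" if "J \<in> Pow I" for J
  proof -
    have fin: "finite J" "J \<subseteq> I"
      using that assms(1) by (auto intro: finite_subset)
    have [measurable]: "(\<lambda>\<omega>. dim ((\<lambda>j. w j \<omega>) ` J)) \<in> measurable M (count_space UNIV)"
      using fin assms by (intro measurable_dim_image) auto
    have [measurable]: "{\<omega> \<in> space M. separable_by J (I - J) (\<lambda>j. w j \<omega>)} \<in> sets M"
      using fin assms by (intro sets_Collect_separable_by) auto
    show ?thesis
      unfolding P_def by measurable
  qed
  have "card (facial_sets I (\<lambda>j. w j \<omega>) r) = (\<Sum>J\<in>Pow I. if P J \<omega> then 1 else 0)" for \<omega>
  proof -
    have "facial_sets I (\<lambda>j. w j \<omega>) r = {J \<in> Pow I. P J \<omega>}"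
      by (auto simp: facial_sets_def P_def)
    then show ?thesis
      using assms(1) by (simp add: sum.If_cases Int_def)
  qed
  moreover have "(\<lambda>\<omega>. \<Sum>J\<in>Pow I. if P J \<omega> then 1 else 0 :: nat) \<in> measurable M (count_space UNIV)"
    using P by (intro measurable_sum_nat measurable_If) auto
  ultimately show ?thesis
    by simp
qed

subsection \<open>Rotation invariance\<close>

text \<open>Uniqueness of Haar measure, with the factor fixed by the unit ball \<open>?A\<close>.
  The double integral of \<open>indicator ?A x * indicator B (x + y)\<close> is evaluated in both
  orders by Fubini, with the translation invariance of both measures.\<close>

lemma translation_invariant_eq_lborel:
  fixes N :: "'a::euclidean_space measure"
  assumes sets_N [measurable_cong]: "sets N = sets borel"
    and "sigma_finite_measure N"
    and transl: "\<And>a. distr N borel (\<lambda>x. a + x) = N"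
    and ball: "emeasure N (ball 0 1) = emeasure lborel (ball (0::'a) 1)"
  shows "N = lborel"
proof (rule measure_eqI)
  interpret N: sigma_finite_measure N by fact
  interpret pair_sigma_finite lborel N ..
  let ?A = "ball (0::'a) 1"
  have [measurable]: "?A \<in> sets borel"
    by simp
  have pair: "borel_measurable (lborel \<Otimes>\<^sub>M N) = (borel_measurable (borel \<Otimes>\<^sub>M borel) :: ('a \<times> 'a \<Rightarrow> ennreal) set)"
    by (intro measurable_cong_sets sets_pair_measure_cong) (auto simp: sets_N)
  have N_translate: "(\<integral>\<^sup>+y. f y \<partial>N) = (\<integral>\<^sup>+y. f (a + y) \<partial>N)" if "f \<in> borel_measurable borel" for f a
  proof -
    have "(\<integral>\<^sup>+y. f y \<partial>N) = (\<integral>\<^sup>+y. f y \<partial>distr N borel (\<lambda>x. a + x))"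
      by (simp add: transl)
    also have "\<dots> = (\<integral>\<^sup>+y. f (a + y) \<partial>N)"
      using that by (intro nn_integral_distr) auto
    finally show ?thesis .
  qed
  have L_translate: "(\<integral>\<^sup>+y. f y \<partial>lborel) = (\<integral>\<^sup>+y. f (a + y) \<partial>lborel)"
    if "f \<in> borel_measurable borel" for f and a :: 'a
  proof -
    have "(\<integral>\<^sup>+y. f y \<partial>lborel) = (\<integral>\<^sup>+y. f y \<partial>distr lborel borel (\<lambda>x. a + x))"
      by (simp add: lborel_distr_plus)
    also have "\<dots> = (\<integral>\<^sup>+y. f (a + y) \<partial>lborel)"
      using that by (intro nn_integral_distr) auto
    finally show ?thesis .
  qed
  fix B assume "B \<in> sets N"
  then have B [measurable]: "B \<in> sets borel"
    by (simp add: sets_N)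
  have "emeasure lborel ?A * emeasure N B =
      (\<integral>\<^sup>+x. indicator ?A x * (\<integral>\<^sup>+y. indicator B y \<partial>N) \<partial>lborel)"
    by (subst nn_integral_multc) (auto simp: sets_N)
  also have "\<dots> = (\<integral>\<^sup>+x. (\<integral>\<^sup>+y. indicator ?A x * indicator B (x + y) \<partial>N) \<partial>lborel)"
  proof (rule nn_integral_cong)
    fix x :: 'a
    have "(\<integral>\<^sup>+y. indicator B y \<partial>N) = (\<integral>\<^sup>+y. indicator B (x + y) \<partial>N)"
      by (rule N_translate) auto
    then show "indicator ?A x * (\<integral>\<^sup>+y. indicator B y \<partial>N) =
        (\<integral>\<^sup>+y. indicator ?A x * indicator B (x + y) \<partial>N)"
      by (simp add: nn_integral_cmult)
  qed
  also have "\<dots> = (\<integral>\<^sup>+y. (\<integral>\<^sup>+x. indicator ?A x * indicator B (x + y) \<partial>lborel) \<partial>N)"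
    by (subst Fubini') (auto simp: pair)
  also have "\<dots> = (\<integral>\<^sup>+y. (\<integral>\<^sup>+x. indicator ?A (x - y) * indicator B x \<partial>lborel) \<partial>N)"
  proof (rule nn_integral_cong)
    fix y :: 'a
    have "(\<integral>\<^sup>+x. indicator ?A x * indicator B (x + y) \<partial>lborel) =
        (\<integral>\<^sup>+x. indicator ?A (- y + x) * indicator B (- y + x + y) \<partial>lborel)"
      by (rule L_translate) auto
    then show "(\<integral>\<^sup>+x. indicator ?A x * indicator B (x + y) \<partial>lborel) =
        (\<integral>\<^sup>+x. indicator ?A (x - y) * indicator B x \<partial>lborel)"
      by simp
  qed
  also have "\<dots> = (\<integral>\<^sup>+x. (\<integral>\<^sup>+y. indicator ?A (x - y) * indicator B x \<partial>N) \<partial>lborel)"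
    by (subst Fubini') (auto simp: pair)
  also have "\<dots> = (\<integral>\<^sup>+x. emeasure N ?A * indicator B x \<partial>lborel)"
  proof (rule nn_integral_cong)
    fix x
    \<comment> \<open>After the shift by \<open>x\<close> the argument is \<open>- y\<close>, and
      the ball is symmetric.\<close>
    have "(\<integral>\<^sup>+y. indicator ?A (x - y) \<partial>N) = (\<integral>\<^sup>+y. indicator ?A (x - (x + y)) \<partial>N)"
      by (subst N_translate[where a = x]) auto
    also have "\<dots> = (\<integral>\<^sup>+y. indicator ?A y \<partial>N)"
      by (simp add: indicator_def)
    finally show "(\<integral>\<^sup>+y. indicator ?A (x - y) * indicator B x \<partial>N) = emeasure N ?A * indicator B x"
      by (simp add: nn_integral_multc sets_N)
  qed
  also have "\<dots> = emeasure lborel ?A * emeasure lborel B"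
    by (simp add: nn_integral_cmult_indicator ball)
  finally have eq: "emeasure lborel ?A * emeasure N B = emeasure lborel ?A * emeasure lborel B" .
  have "emeasure lborel ?A \<noteq> 0"
    using content_ball_pos[of 1 "0::'a"] by (auto simp: measure_def)
  moreover have "emeasure lborel ?A \<noteq> \<top>"
    using emeasure_lborel_ball_finite[of 0 1] by (simp add: less_top)
  ultimately show "emeasure N B = emeasure lborel B"
    using eq by (simp add: ennreal_mult_cancel_left)
qed (simp add: sets_N)

text \<open>Every translation vector has the form \<open>T b\<close>, and \<open>T\<close> carries
  translation by \<open>b\<close> to translation by \<open>T b\<close>, so the image measure is
  translation invariant. Balls about the origin are their own preimages, which settles normalization
  and sigma-finiteness.\<close>

lemma distr_lborel_orthogonal_transformation:
  fixes T :: "'a::euclidean_space \<Rightarrow> 'a"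
  assumes T: "orthogonal_transformation T"
  shows "distr lborel borel T = lborel"
proof (rule translation_invariant_eq_lborel)
  have lin: "linear T"
    using T by (rule orthogonal_transformation_linear)
  have meas [measurable]: "T \<in> borel_measurable borel"
    using lin by (intro borel_measurable_continuous_onI linear_continuous_on) (simp add: linear_conv_bounded_linear)
  have vimage_ball: "T -` ball 0 r = ball 0 r" for r
    using orthogonal_transformation_norm[OF T] by auto
  have ball: "emeasure (distr lborel borel T) (ball 0 r) = emeasure lborel (ball (0::'a) r)" for r
    by (subst emeasure_distr) (auto simp: vimage_ball)
  then show "emeasure (distr lborel borel T) (ball 0 1) = emeasure lborel (ball (0::'a) 1)" .
  show "sigma_finite_measure (distr lborel borel T)"
  proof
    have "\<Union>(range (\<lambda>n::nat. ball (0::'a) (real n))) = UNIV"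
      by (auto simp: reals_Archimedean2)
    moreover have "emeasure lborel (ball (0::'a) r) \<noteq> \<top>" for r
      using emeasure_lborel_ball_finite[of "0::'a" r] by (simp add: less_top)
    ultimately show "\<exists>A. countable A \<and> A \<subseteq> sets (distr lborel borel T) \<and>
        \<Union>A = space (distr lborel borel T) \<and> (\<forall>a\<in>A. emeasure (distr lborel borel T) a \<noteq> \<infinity>)"
      by (intro exI[of _ "range (\<lambda>n::nat. ball (0::'a) (real n))"]) (auto simp: ball)
  qed
  fix a
  obtain b where b: "a = T b"
    using surjD[OF orthogonal_transformation_surj[OF T]] by blast
  have "distr (distr lborel borel T) borel (\<lambda>x. a + x) = distr lborel borel (\<lambda>x. T (b + x))"
    by (subst distr_distr) (auto simp: o_def b linear_add[OF lin])
  also have "\<dots> = distr (distr lborel borel (\<lambda>x. b + x)) borel T"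
    by (subst distr_distr) (auto simp: o_def)
  also have "\<dots> = distr lborel borel T"
    by (simp add: lborel_distr_plus)
  finally show "distr (distr lborel borel T) borel (\<lambda>x. a + x) = distr lborel borel T" .
qed simp

section \<open>The uniform measure on the sphere\<close>

lemma borel_measurable_sgn_euclidean [measurable]:
  "sgn \<in> borel_measurable (borel :: 'a::euclidean_space measure)"
  unfolding sgn_div_norm by measurable

lemma space_sphere_measure [simp]: "space sphere_measure = sphere 0 1"
  by (simp add: sphere_measure_def space_restrict_space)

lemma sets_sphere_measure [measurable_cong]:
  "sets sphere_measure = sets (restrict_space borel (sphere 0 1))"
  by (simp add: sphere_measure_def sets_restrict_space)

lemma emeasure_lborel_cball_pos:
  "0 < emeasure lborel (cball (0::'a::euclidean_space) 1)"
  using content_cball_pos[of 1 "0::'a"] emeasure_lborel_cball_finite[of "0::'a" 1]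
  by (simp add: measure_def zero_less_iff_neq_zero enn2real_positive_iff)

lemma emeasure_sphere_measure:
  fixes A :: "'a::euclidean_space set"
  assumes [measurable]: "A \<in> sets borel" and "A \<subseteq> sphere 0 1"
  shows "emeasure sphere_measure A =
    emeasure lborel (cball 0 1 \<inter> sgn -` A) / emeasure lborel (cball (0::'a) 1)"
proof -
  let ?U = "uniform_measure lborel (cball (0::'a) 1)"
  have "emeasure sphere_measure A = emeasure (distr ?U borel sgn) A"
    unfolding sphere_measure_def using assms by (intro emeasure_restrict_space) auto
  also have "\<dots> = emeasure ?U (sgn -` A)"
    by (subst emeasure_distr) auto
  also have "\<dots> = emeasure lborel (cball 0 1 \<inter> sgn -` A) / emeasure lborel (cball (0::'a) 1)"
  proof (rule emeasure_uniform_measure)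
    show "sgn -` A \<in> sets lborel"
      using measurable_sets[OF borel_measurable_sgn_euclidean assms(1)] by simp
  qed auto
  finally show ?thesis .
qed

lemma prob_space_sphere_measure: "prob_space (sphere_measure :: 'a::euclidean_space measure)"
proof
  \<comment> \<open>As \<open>sgn 0 = 0\<close>, the origin is the only point of the ball that does
    not project to the sphere.\<close>
  have "cball 0 1 \<inter> sgn -` sphere 0 1 = cball 0 1 - {0::'a}"
    by (auto simp: norm_sgn)
  then have "emeasure lborel (cball 0 1 \<inter> sgn -` sphere (0::'a) 1) = emeasure lborel (cball (0::'a) 1)"
    by (simp add: emeasure_Diff_null_set finite_imp_null_set_lborel)
  then show "emeasure sphere_measure (space (sphere_measure :: 'a measure)) = 1"
    using emeasure_lborel_cball_pos[where 'a='a] emeasure_lborel_cball_finite[of "0::'a" 1]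
    by (simp add: emeasure_sphere_measure ennreal_divide_self zero_less_iff_neq_zero)
qed

text \<open>\<open>T\<close> preserves the ball and Lebesgue measure and commutes with the radial
  projection \<open>sgn\<close>.\<close>

lemma distr_sphere_measure_orthogonal_transformation:
  fixes T :: "'a::euclidean_space \<Rightarrow> 'a"
  assumes T: "orthogonal_transformation T"
  shows "T \<in> measurable sphere_measure sphere_measure"
    and "distr sphere_measure sphere_measure T = sphere_measure"
proof -
  have lin: "linear T"
    using T by (rule orthogonal_transformation_linear)
  have meas [measurable]: "T \<in> borel_measurable borel"
    using lin by (intro borel_measurable_continuous_onI linear_continuous_on) (simp add: linear_conv_bounded_linear)
  show meas_sphere: "T \<in> measurable sphere_measure sphere_measure"
    using orthogonal_transformation_norm[OF T]
    by (intro measurable_cong_sets[THEN equalityD1, THEN subsetD, OF sets_sphere_measure[symmetric] sets_sphere_measure[symmetric]]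
         measurable_restrict_space2 measurable_restrict_space1 meas) (auto simp: space_restrict_space)
  have sgn_T: "sgn (T x) = T (sgn x)" for x
    using orthogonal_transformation_norm[OF T] by (simp add: sgn_div_norm linear_scale[OF lin])
  show "distr sphere_measure sphere_measure T = sphere_measure"
  proof (rule measure_eqI)
    fix A :: "'a set" assume "A \<in> sets (distr sphere_measure sphere_measure T)"
    then have A: "A \<in> sets sphere_measure" "A \<in> sets borel" "A \<subseteq> sphere 0 1"
      by (auto simp: sets_sphere_measure sets_restrict_space_iff)
    have "T -` A \<in> sets borel"
      using measurable_sets[OF meas A(2)] by simp
    moreover have sub: "T -` A \<subseteq> sphere 0 1"
      using A(3) orthogonal_transformation_norm[OF T] by auto
    ultimately have "emeasure (distr sphere_measure sphere_measure T) A =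
        emeasure lborel (cball 0 1 \<inter> sgn -` (T -` A)) / emeasure lborel (cball (0::'a) 1)"
      using A(1) by (subst emeasure_distr[OF meas_sphere]) (auto simp: emeasure_sphere_measure Int_absorb2)
    also have "cball 0 1 \<inter> sgn -` (T -` A) = T -` (cball 0 1 \<inter> sgn -` A)"
      using orthogonal_transformation_norm[OF T] by (auto simp: sgn_T)
    also have "emeasure lborel (T -` (cball 0 1 \<inter> sgn -` A)) =
        emeasure (distr lborel borel T) (cball 0 1 \<inter> sgn -` A)"
      using A(2) measurable_sets[OF borel_measurable_sgn_euclidean A(2)]
      by (subst emeasure_distr) auto
    also have "\<dots> / emeasure lborel (cball (0::'a) 1) = emeasure sphere_measure A"
      by (simp add: distr_lborel_orthogonal_transformation[OF T] emeasure_sphere_measure A)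
    finally show "emeasure (distr sphere_measure sphere_measure T) A = emeasure sphere_measure A" .
  qed simp
qed

subsection \<open>Stereographic projection\<close>

text \<open>The negative of stereographic projection from the north pole \<open>(1, 0)\<close>,
  extended from the sphere so that it is constant along rays from the origin. At the pole, division
  by zero yields the value 0.\<close>

definition stereographic :: "real \<times> 'a::euclidean_space \<Rightarrow> 'a" where
  "stereographic w = (- 1 / (norm w - fst w)) *\<^sub>R snd w"

lemma borel_measurable_stereographic [measurable]:
  "stereographic \<in> borel_measurable (borel :: (real \<times> 'a::euclidean_space) measure)"
proof -
  have "(\<lambda>w::real \<times> 'a. fst w) \<in> borel_measurable borel" "(\<lambda>w::real \<times> 'a. snd w) \<in> borel_measurable borel"
    by (auto intro!: borel_measurable_continuous_onI continuous_intros)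
  note [measurable] = this
  show ?thesis
    unfolding stereographic_def[abs_def] by measurable
qed

lemma stereographic_sgn:
  assumes "w \<noteq> 0"
  shows "stereographic (sgn w) = stereographic w"
proof -
  have "norm (sgn w) - fst (sgn w) = (norm w - fst w) / norm w"
    using assms by (simp add: norm_sgn sgn_div_norm field_simps)
  then show ?thesis
    using assms by (simp add: stereographic_def sgn_div_norm divide_inverse_commute)
qed

text \<open>The substitution \<open>s = sqrt (t\<^sup>2 + c) - t\<close>.\<close>

lemma lborel_substitution_hyperbola:
  fixes c :: real
  assumes c: "c > 0"
  shows "lborel = distr (density lborel (\<lambda>s. indicator {0<..} s * ennreal ((c + s\<^sup>2) / (2 * s\<^sup>2)))) borel
    (\<lambda>s. (c - s\<^sup>2) / (2 * s))"
proof (rule lborel_eqI)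
  let ?h = "\<lambda>s. (c + s\<^sup>2) / (2 * s\<^sup>2)" and ?T = "\<lambda>s. (c - s\<^sup>2) / (2 * s)"
  \<comment> \<open>\<open>S\<close> is the inverse of \<open>?T\<close> on the positive half-line;
    both are decreasing.\<close>
  define S where "S t = sqrt (t\<^sup>2 + c) - t" for t
  have S_pos: "S t > 0" for t
  proof -
    have "\<bar>t\<bar> < sqrt (t\<^sup>2 + c)"
      using c by (intro real_less_rsqrt) auto
    then show ?thesis
      by (simp add: S_def)
  qed
  have T_S: "?T (S t) = t" for t
  proof -
    have "c - (S t)\<^sup>2 = t * (2 * S t)"
      using c by (simp add: S_def power2_diff algebra_simps) (simp add: power2_eq_square)
    then show ?thesis
      using S_pos[of t] by (simp add: field_simps)
  qed
  have T_less: "?T s < ?T s'" if "0 < s'" "s' < s" for s s'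
  proof -
    have "s'\<^sup>2 * s < s\<^sup>2 * s'"
      using that by (simp add: power2_eq_square)
    moreover have "c * s' < c * s"
      using c that by simp
    ultimately have "(c - s\<^sup>2) * s' < (c - s'\<^sup>2) * s"
      by (simp add: algebra_simps)
    then show ?thesis
      using that by (simp add: divide_simps)
  qed
  have T_iff: "?T s < t \<longleftrightarrow> S t < s" "t < ?T s \<longleftrightarrow> s < S t" if "s > 0" for s t
    using T_less[of s "S t"] T_less[of "S t" s] T_S[of t] S_pos[of t] that
    by (metis linorder_neqE_linordered_idom order.asym)+
  fix l u :: real
  assume "\<And>b. b \<in> Basis \<Longrightarrow> l \<bullet> b \<le> u \<bullet> b"
  then have lu: "l \<le> u"
    by simp
  have Slu: "S u \<le> S l"
    using T_less[of "S l" "S u"] T_S S_pos lu by (metis not_le)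
  have [measurable]: "?T \<in> borel_measurable borel"
    by measurable
  have [measurable]: "?T -` {l<..<u} \<in> sets borel"
    using measurable_sets[of ?T borel borel "{l<..<u}"] by simp
  have "emeasure (distr (density lborel (\<lambda>s. indicator {0<..} s * ennreal (?h s))) borel ?T) (box l u) =
      (\<integral>\<^sup>+s. indicator {0<..} s * ennreal (?h s) * indicator (?T -` {l<..<u}) s \<partial>lborel)"
    by (subst emeasure_distr) (auto simp: emeasure_density)
  also have "\<dots> = (\<integral>\<^sup>+s. ennreal (?h s) * indicator {S u..S l} s \<partial>lborel)"
  proof (rule nn_integral_cong_AE)
    \<comment> \<open>The preimage within the positive half-line is an open interval, while the
      fundamental theorem integrates over a closed one; the two endpoints form a null set.\<close>
    have "AE s in lborel. s \<noteq> S u \<and> s \<noteq> S l"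
      by (intro AE_conjI AE_lborel_singleton)
    then show "AE s in lborel. indicator {0<..} s * ennreal (?h s) * indicator (?T -` {l<..<u}) s =
        ennreal (?h s) * indicator {S u..S l} s"
    proof eventually_elim
      case (elim s)
      show ?case
      proof (cases "s > 0")
        case True
        have "s \<in> ?T -` {l<..<u} \<longleftrightarrow> S u < s \<and> s < S l"
          using T_iff[OF True] by (simp add: conj_commute)
        then have "s \<in> ?T -` {l<..<u} \<longleftrightarrow> s \<in> {S u..S l}"
          using elim by (simp add: less_le)
        then show ?thesis
          using True by (simp only: indicator_def) simp
      next
        case False
        then show ?thesis
          using S_pos[of u] by (auto simp: indicator_def)
      qed
    qed
  qed
  also have "\<dots> = ennreal ((- ?T (S l)) - (- ?T (S u)))"
  \<comment> \<open>\<open>?T\<close> decreases, so the antiderivative of the positive density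
    \<open>?h\<close> is \<open>- ?T\<close>.\<close>
  proof (rule nn_integral_FTC_Icc[where F = "\<lambda>s. - ?T s"])
    fix s assume "s \<in> {S u..S l}"
    then have s: "s > 0"
      using S_pos[of u] by simp
    show "DERIV (\<lambda>s. - ?T s) s :> ?h s"
      using s by (auto intro!: derivative_eq_intros simp: field_simps power2_eq_square)
    show "0 \<le> ?h s"
      using c by simp
  qed (use Slu in auto)
  also have "\<dots> = ennreal (u - l)"
    by (simp only: T_S) simp
  finally show "emeasure (distr (density lborel (\<lambda>s. indicator {0<..} s * ennreal (?h s))) borel ?T) (box l u) =
      ennreal (\<Prod>b\<in>Basis. (u - l) \<bullet> b)"
    by simp
qed simp

lemma nn_integral_substitution_hyperbola:
  fixes c :: real
  assumes "c > 0" and [measurable]: "f \<in> borel_measurable borel"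
  shows "(\<integral>\<^sup>+t. f t \<partial>lborel) =
    (\<integral>\<^sup>+s. indicator {0<..} s * ennreal ((c + s\<^sup>2) / (2 * s\<^sup>2)) * f ((c - s\<^sup>2) / (2 * s)) \<partial>lborel)"
  by (subst lborel_substitution_hyperbola[OF assms(1)])
    (simp add: nn_integral_distr nn_integral_density)

lemma nn_integral_lborel_scaleR:
  fixes f :: "'a::euclidean_space \<Rightarrow> ennreal"
  assumes "c \<noteq> 0" and [measurable]: "f \<in> borel_measurable borel"
  shows "(\<integral>\<^sup>+x. f x \<partial>lborel) = ennreal (\<bar>c\<bar> ^ DIM('a)) * (\<integral>\<^sup>+x. f (c *\<^sub>R x) \<partial>lborel)"
  by (subst lborel_affine[OF assms(1), of 0])
    (simp add: nn_integral_distr nn_integral_density nn_integral_cmult)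

lemma nn_integral_power_atLeast_0:
  assumes "a \<ge> 0"
  shows "(\<integral>\<^sup>+s. ennreal (s ^ d) * indicator {0..a} s \<partial>lborel) = ennreal (a ^ Suc d / Suc d)"
proof -
  have "(\<integral>\<^sup>+s. ennreal (s ^ d) * indicator {0..a} s \<partial>lborel) =
      ennreal (a ^ Suc d / Suc d - 0 ^ Suc d / Suc d)"
  proof (rule nn_integral_FTC_Icc[where F = "\<lambda>s. s ^ Suc d / Suc d"])
    fix s :: real
    assume "s \<in> {0..a}"
    show "((\<lambda>s. s ^ Suc d / Suc d) has_real_derivative s ^ d) (at s)"
      using DERIV_cdivide[OF DERIV_pow[of "Suc d" s], of "real (Suc d)"] by (simp del: of_nat_Suc)
    show "0 \<le> s ^ d"
      using \<open>s \<in> {0..a}\<close> by simp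
  qed (use assms in auto)
  then show ?thesis
    by simp
qed

text \<open>For \<open>t = ((norm u)\<^sup>2 - s\<^sup>2) / (2 * s)\<close> the equation
  \<open>norm (t, u) - t = s\<close> holds, so the norm is \<open>t + s\<close>.\<close>

lemma norm_Pair_hyperbola:
  assumes "s > 0"
  shows "norm (((norm u)\<^sup>2 - s\<^sup>2) / (2 * s), u) = ((norm u)\<^sup>2 + s\<^sup>2) / (2 * s)"
proof -
  have "(((norm u)\<^sup>2 - s\<^sup>2) / (2 * s))\<^sup>2 + (norm u)\<^sup>2 = (((norm u)\<^sup>2 + s\<^sup>2) / (2 * s))\<^sup>2"
    using assms by (simp add: power_divide field_simps power2_eq_square)
  then show ?thesis
    using assms by (simp only: norm_Pair real_norm_def power2_abs) simp
qed

lemma stereographic_hyperbola: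
  assumes "s > 0"
  shows "stereographic (((norm u)\<^sup>2 - s\<^sup>2) / (2 * s), u) = (- 1 / s) *\<^sub>R u"
proof -
  have "((norm u)\<^sup>2 + s\<^sup>2) / (2 * s) - ((norm u)\<^sup>2 - s\<^sup>2) / (2 * s) = s"
    using assms by (simp add: field_simps power2_eq_square)
  then show ?thesis
    using norm_Pair_hyperbola[OF assms, of u] by (simp add: stereographic_def)
qed

text \<open>For fixed \<open>u \<noteq> 0\<close> the variable \<open>t\<close> is replaced by
  \<open>s = norm (t, u) - t\<close>, which makes the projection \<open>- u / s\<close>. After the
  integrals are exchanged, \<open>u = - s y\<close> contributes \<open>s ^ d\<close> with
  \<open>d = DIM('a)\<close> and turns the ball into
  \<open>0 < s \<le> 2 / (1 + (norm y)\<^sup>2)\<close>. What remains is the integral of a power of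
  \<open>s\<close>.\<close>

lemma emeasure_stereographic_vimage:
  fixes B :: "'a::euclidean_space set"
  assumes [measurable]: "B \<in> sets borel"
  shows "emeasure lborel (cball 0 1 \<inter> stereographic -` B) =
    (\<integral>\<^sup>+y. ennreal (2 ^ DIM('a) / (DIM('a) + 1) * (1 + (norm y)\<^sup>2) powr (- real DIM('a))) * indicator B y \<partial>lborel)"
proof -
  let ?d = "DIM('a)"
  have [measurable]: "cball 0 1 \<inter> stereographic -` B \<in> sets (borel :: (real \<times> 'a) measure)"
    using measurable_sets[OF borel_measurable_stereographic assms] by auto
  have "emeasure lborel (cball 0 1 \<inter> stereographic -` B) =
      (\<integral>\<^sup>+w. indicator (cball 0 1 \<inter> stereographic -` B) w \<partial>(lborel \<Otimes>\<^sub>M lborel))"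
    by (simp add: lborel_prod)
  also have "\<dots> = (\<integral>\<^sup>+u. \<integral>\<^sup>+t. indicator (cball 0 1 \<inter> stereographic -` B) (t, u) \<partial>lborel \<partial>lborel)"
    by (rule lborel_pair.nn_integral_snd[symmetric]) (simp add: lborel_prod)
  also have "\<dots> = (\<integral>\<^sup>+u. \<integral>\<^sup>+s. indicator {0<..} s * ennreal (((norm u)\<^sup>2 + s\<^sup>2) / (2 * s\<^sup>2)) *
      (indicator {..1} (((norm u)\<^sup>2 + s\<^sup>2) / (2 * s)) * indicator B ((- 1 / s) *\<^sub>R u)) \<partial>lborel \<partial>lborel)"
  proof (rule nn_integral_cong_AE)
    \<comment> \<open>The substitution in \<open>t\<close> needs
      \<open>(norm u)\<^sup>2 > 0\<close>.\<close>
    have "AE u in (lborel :: 'a measure). u \<noteq> 0"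
      by (rule AE_lborel_singleton)
    then show "AE u in lborel. (\<integral>\<^sup>+t. indicator (cball 0 1 \<inter> stereographic -` B) (t, u) \<partial>lborel) =
      (\<integral>\<^sup>+s. indicator {0<..} s * ennreal (((norm u)\<^sup>2 + s\<^sup>2) / (2 * s\<^sup>2)) *
      (indicator {..1} (((norm u)\<^sup>2 + s\<^sup>2) / (2 * s)) * indicator B ((- 1 / s) *\<^sub>R u)) \<partial>lborel)"
    proof eventually_elim
      case (elim u)
      have "(\<integral>\<^sup>+t. indicator (cball 0 1 \<inter> stereographic -` B) (t, u) \<partial>lborel) =
        (\<integral>\<^sup>+s. indicator {0<..} s * ennreal (((norm u)\<^sup>2 + s\<^sup>2) / (2 * s\<^sup>2)) *
          indicator (cball 0 1 \<inter> stereographic -` B) (((norm u)\<^sup>2 - s\<^sup>2) / (2 * s), u) \<partial>lborel)"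
        using elim by (intro nn_integral_substitution_hyperbola) auto
      also have "\<dots> = (\<integral>\<^sup>+s. indicator {0<..} s * ennreal (((norm u)\<^sup>2 + s\<^sup>2) / (2 * s\<^sup>2)) *
          (indicator {..1} (((norm u)\<^sup>2 + s\<^sup>2) / (2 * s)) * indicator B ((- 1 / s) *\<^sub>R u)) \<partial>lborel)"
      proof (rule nn_integral_cong)
        fix s :: real
        show "indicator {0<..} s * ennreal (((norm u)\<^sup>2 + s\<^sup>2) / (2 * s\<^sup>2)) *
            indicator (cball 0 1 \<inter> stereographic -` B) (((norm u)\<^sup>2 - s\<^sup>2) / (2 * s), u) =
          indicator {0<..} s * ennreal (((norm u)\<^sup>2 + s\<^sup>2) / (2 * s\<^sup>2)) *
            (indicator {..1} (((norm u)\<^sup>2 + s\<^sup>2) / (2 * s)) * indicator B ((- 1 / s) *\<^sub>R u))"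
        proof (cases "s > 0")
          case True
          have "(((norm u)\<^sup>2 - s\<^sup>2) / (2 * s), u) \<in> cball 0 1 \<inter> stereographic -` B \<longleftrightarrow>
              ((norm u)\<^sup>2 + s\<^sup>2) / (2 * s) \<in> {..1} \<and> (- 1 / s) *\<^sub>R u \<in> B"
            using norm_Pair_hyperbola[OF True, of u] stereographic_hyperbola[OF True, of u] by simp
          then show ?thesis
            by (simp add: indicator_def)
        qed simp
      qed
      finally show ?case .
    qed
  qed
  also have "\<dots> = (\<integral>\<^sup>+s. \<integral>\<^sup>+u. indicator {0<..} s * ennreal (((norm u)\<^sup>2 + s\<^sup>2) / (2 * s\<^sup>2)) *
      (indicator {..1} (((norm u)\<^sup>2 + s\<^sup>2) / (2 * s)) * indicator B ((- 1 / s) *\<^sub>R u)) \<partial>lborel \<partial>lborel)"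
    by (rule lborel_pair.Fubini') measurable
  also have "\<dots> = (\<integral>\<^sup>+s. \<integral>\<^sup>+y. ennreal ((1 + (norm y)\<^sup>2) / 2) * indicator B y *
      (ennreal (s ^ ?d) * indicator {0..2 / (1 + (norm y)\<^sup>2)} s) \<partial>lborel \<partial>lborel)"
  proof (rule nn_integral_cong_AE)
    \<comment> \<open>The point \<open>s = 0\<close> belongs to the closed interval on the right but
      not to \<open>{0<..}\<close>.\<close>
    have "AE s in (lborel :: real measure). s \<noteq> 0"
      by (rule AE_lborel_singleton)
    then show "AE s in lborel. (\<integral>\<^sup>+(u::'a). indicator {0<..} s * ennreal (((norm u)\<^sup>2 + s\<^sup>2) / (2 * s\<^sup>2)) *
        (indicator {..1} (((norm u)\<^sup>2 + s\<^sup>2) / (2 * s)) * indicator B ((- 1 / s) *\<^sub>R u)) \<partial>lborel) =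
      (\<integral>\<^sup>+y. ennreal ((1 + (norm y)\<^sup>2) / 2) * indicator B y *
        (ennreal (s ^ ?d) * indicator {0..2 / (1 + (norm y)\<^sup>2)} s) \<partial>lborel)"
    proof eventually_elim
      case (elim s)
      show ?case
      proof (cases "s > 0")
        case False
        then have "indicator {0..2 / (1 + (norm y)\<^sup>2)} s = (0::ennreal)" for y :: 'a
          using elim by (auto simp: indicator_def)
        then show ?thesis
          using False by simp
      next
        case s: True
        have "(\<integral>\<^sup>+(u::'a). indicator {0<..} s * ennreal (((norm u)\<^sup>2 + s\<^sup>2) / (2 * s\<^sup>2)) *
            (indicator {..1} (((norm u)\<^sup>2 + s\<^sup>2) / (2 * s)) * indicator B ((- 1 / s) *\<^sub>R u)) \<partial>lborel) =
          ennreal (\<bar>- s\<bar> ^ ?d) * (\<integral>\<^sup>+(y::'a). indicator {0<..} s * ennreal (((norm (- s *\<^sub>R y))\<^sup>2 + s\<^sup>2) / (2 * s\<^sup>2)) *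
            (indicator {..1} (((norm (- s *\<^sub>R y))\<^sup>2 + s\<^sup>2) / (2 * s)) * indicator B ((- 1 / s) *\<^sub>R (- s *\<^sub>R y))) \<partial>lborel)"
          using s by (intro nn_integral_lborel_scaleR) auto
        also have "\<dots> = (\<integral>\<^sup>+(y::'a). ennreal (\<bar>- s\<bar> ^ ?d) * (indicator {0<..} s * ennreal (((norm (- s *\<^sub>R y))\<^sup>2 + s\<^sup>2) / (2 * s\<^sup>2)) *
            (indicator {..1} (((norm (- s *\<^sub>R y))\<^sup>2 + s\<^sup>2) / (2 * s)) * indicator B ((- 1 / s) *\<^sub>R (- s *\<^sub>R y)))) \<partial>lborel)"
          by (rule nn_integral_cmult[symmetric]) measurable
        also have "\<dots> = (\<integral>\<^sup>+y. ennreal ((1 + (norm y)\<^sup>2) / 2) * indicator B y *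
            (ennreal (s ^ ?d) * indicator {0..2 / (1 + (norm y)\<^sup>2)} s) \<partial>lborel)"
        proof (rule nn_integral_cong)
          fix y :: 'a
          have pos: "1 + (norm y)\<^sup>2 > 0"
            by (simp add: add_pos_nonneg)
          have "((norm (- s *\<^sub>R y))\<^sup>2 + s\<^sup>2) / (2 * s\<^sup>2) = (1 + (norm y)\<^sup>2) / 2"
            using s by (simp add: power_mult_distrib field_simps)
          moreover have "((norm (- s *\<^sub>R y))\<^sup>2 + s\<^sup>2) / (2 * s) = s * (1 + (norm y)\<^sup>2) / 2"
            using s by (simp add: power_mult_distrib field_simps power2_eq_square)
          moreover have "(- 1 / s) *\<^sub>R (- s *\<^sub>R y) = y"
            using s by simp
          moreover have "indicator {..1} (s * (1 + (norm y)\<^sup>2) / 2) =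
              (indicator {0..2 / (1 + (norm y)\<^sup>2)} s :: ennreal)"
            using s pos by (simp add: indicator_def field_simps)
          ultimately show "ennreal (\<bar>- s\<bar> ^ ?d) * (indicator {0<..} s * ennreal (((norm (- s *\<^sub>R y))\<^sup>2 + s\<^sup>2) / (2 * s\<^sup>2)) *
              (indicator {..1} (((norm (- s *\<^sub>R y))\<^sup>2 + s\<^sup>2) / (2 * s)) * indicator B ((- 1 / s) *\<^sub>R (- s *\<^sub>R y)))) =
            ennreal ((1 + (norm y)\<^sup>2) / 2) * indicator B y *
              (ennreal (s ^ ?d) * indicator {0..2 / (1 + (norm y)\<^sup>2)} s)"
            using s by (simp only: abs_minus_cancel abs_of_pos) (simp add: mult_ac)
        qed
        finally show ?thesis .
      qed
    qed
  qed
  also have "\<dots> = (\<integral>\<^sup>+y. \<integral>\<^sup>+s. ennreal ((1 + (norm y)\<^sup>2) / 2) * indicator B y *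
      (ennreal (s ^ ?d) * indicator {0..2 / (1 + (norm y)\<^sup>2)} s) \<partial>lborel \<partial>lborel)"
    by (rule lborel_pair.Fubini') (simp add: indicator_def, measurable)
  also have "\<dots> = (\<integral>\<^sup>+y. ennreal (2 ^ ?d / (?d + 1) * (1 + (norm y)\<^sup>2) powr (- real ?d)) * indicator B y \<partial>lborel)"
  proof (rule nn_integral_cong)
    fix y :: 'a
    define q where "q = 1 + (norm y)\<^sup>2"
    have q: "q > 0"
      by (simp add: q_def add_pos_nonneg)
    have "(\<integral>\<^sup>+s. ennreal (q / 2) * indicator B y * (ennreal (s ^ ?d) * indicator {0..2 / q} s) \<partial>lborel) =
        ennreal (q / 2) * indicator B y * ennreal ((2 / q) ^ Suc ?d / Suc ?d)"
      using q by (subst nn_integral_cmult) (auto simp: nn_integral_power_atLeast_0)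
    also have "\<dots> = ennreal (q / 2 * ((2 / q) ^ Suc ?d / Suc ?d)) * indicator B y"
      using q by (subst ennreal_mult) (auto simp: mult_ac)
    \<comment> \<open>One of the \<open>d + 1\<close> factors \<open>2 / q\<close> cancels against
      \<open>q / 2\<close>, which leaves the beta' exponent \<open>d\<close>.\<close>
    also have "q / 2 * ((2 / q) ^ Suc ?d / Suc ?d) = (2 / q) ^ ?d / (?d + 1)"
      using q by simp
    also have "\<dots> = 2 ^ ?d / (?d + 1) * q powr (- real ?d)"
      using q by (simp add: powr_minus powr_realpow power_divide power_inverse divide_inverse)
    finally show "(\<integral>\<^sup>+s. ennreal ((1 + (norm y)\<^sup>2) / 2) * indicator B y *
        (ennreal (s ^ ?d) * indicator {0..2 / (1 + (norm y)\<^sup>2)} s) \<partial>lborel) =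
      ennreal (2 ^ ?d / (?d + 1) * (1 + (norm y)\<^sup>2) powr (- real ?d)) * indicator B y"
      by (simp only: q_def)
  qed
  finally show ?thesis .
qed

lemma measurable_sphere_measure_borel:
  assumes "f \<in> measurable borel N"
  shows "f \<in> measurable sphere_measure N"
  using measurable_restrict_space1[OF assms, of "sphere 0 1"]
  by (simp add: measurable_cong_sets[OF sets_sphere_measure refl])

text \<open>The projection is constant along rays, so the cone over the preimage on the sphere
  agrees, up to the origin, with the preimage under the extended projection.\<close>

lemma emeasure_distr_stereographic:
  fixes B :: "'a::euclidean_space set"
  assumes B [measurable]: "B \<in> sets borel"
  shows "emeasure (distr sphere_measure borel stereographic) B =
    (\<integral>\<^sup>+y. ennreal (2 ^ DIM('a) / (DIM('a) + 1) * (1 + (norm y)\<^sup>2) powr (- real DIM('a))) * indicator B y \<partial>lborel) /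
    emeasure lborel (cball (0::real \<times> 'a) 1)"
proof -
  let ?S = "sphere (0::real \<times> 'a) 1"
  have V [measurable]: "stereographic -` B \<in> sets (borel :: (real \<times> 'a) measure)"
    using measurable_sets[OF borel_measurable_stereographic B] by simp
  have SV: "stereographic -` B \<inter> ?S \<in> sets borel"
    by measurable
  have "emeasure (distr sphere_measure borel stereographic) B =
      emeasure sphere_measure (stereographic -` B \<inter> ?S)"
    by (subst emeasure_distr) (auto intro: measurable_sphere_measure_borel)
  also have "\<dots> = emeasure lborel (cball 0 1 \<inter> sgn -` (stereographic -` B \<inter> ?S)) /
      emeasure lborel (cball (0::real \<times> 'a) 1)"
    using SV by (intro emeasure_sphere_measure) auto
  also have "emeasure lborel (cball 0 1 \<inter> sgn -` (stereographic -` B \<inter> ?S)) =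
      emeasure lborel (cball 0 1 \<inter> stereographic -` B)"
  proof (rule emeasure_eq_AE)
    have "AE w in (lborel :: (real \<times> 'a) measure). w \<noteq> 0"
      by (rule AE_lborel_singleton)
    then show "AE w in lborel. w \<in> cball 0 1 \<inter> sgn -` (stereographic -` B \<inter> ?S) \<longleftrightarrow>
        w \<in> cball 0 1 \<inter> stereographic -` B"
      by eventually_elim (auto simp: stereographic_sgn norm_sgn)
    show "cball 0 1 \<inter> sgn -` (stereographic -` B \<inter> ?S) \<in> sets lborel"
      using measurable_sets[OF borel_measurable_sgn_euclidean SV] by auto
  qed auto
  also note emeasure_stereographic_vimage[OF B]
  finally show ?thesis .
qed

section \<open>Comparison with the beta' distribution\<close>

definition beta_prime_measure :: "'a::euclidean_space measure" where
  "beta_prime_measure = density lborel (\<lambda>x. ennreal (beta_prime_density (real DIM('a)) x))"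

lemma sets_beta_prime_measure [simp, measurable_cong]: "sets beta_prime_measure = sets borel"
  by (simp add: beta_prime_measure_def)

text \<open>
  Both measures are multiples of \<open>(1 + \<parallel>y\<parallel>\<^sup>2)\<^sup>-\<^sup>d dy\<close>, so the normalization determines the constants.
\<close>

lemma distr_sphere_measure_stereographic:
  assumes "prob_space (beta_prime_measure :: 'a::euclidean_space measure)"
  shows "distr sphere_measure borel stereographic = (beta_prime_measure :: 'a measure)"
proof (rule measure_eqI)
  define m where
    "m B = (\<integral>\<^sup>+y. ennreal ((1 + (norm y)\<^sup>2) powr (- real DIM('a))) * indicator B y \<partial>lborel)" for B :: "'a set"
  define a where
    "a = ennreal (2 ^ DIM('a) / (DIM('a) + 1)) / emeasure lborel (cball (0::real \<times> 'a) 1)"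
  define c where
    "c = Gamma (real DIM('a)) / (pi powr (DIM('a) / 2) * Gamma (real DIM('a) - DIM('a) / 2))"
  have c: "c \<ge> 0"
    unfolding c_def by (intro divide_nonneg_nonneg mult_nonneg_nonneg less_imp_le[OF Gamma_real_pos]) auto
  have stereo: "emeasure (distr sphere_measure borel stereographic) B = a * m B"
    if [measurable]: "B \<in> sets borel" for B
  proof -
    have "emeasure (distr sphere_measure borel stereographic) B =
        ennreal (2 ^ DIM('a) / (DIM('a) + 1)) * m B / emeasure lborel (cball (0::real \<times> 'a) 1)"
      unfolding emeasure_distr_stereographic[OF that] m_def
      by (subst nn_integral_cmult[symmetric]) (auto simp: ennreal_mult' mult.assoc simp del: times_divide_eq_left)
    then show ?thesis
      by (simp add: a_def divide_ennreal_def mult_ac)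
  qed
  have beta: "emeasure beta_prime_measure B = ennreal c * m B" if [measurable]: "B \<in> sets borel" for B :: "'a set"
  proof -
    have "beta_prime_density (real DIM('a)) y = c * (1 + (norm y)\<^sup>2) powr (- real DIM('a))" for y :: 'a
      by (simp add: beta_prime_density_def c_def)
    then have "emeasure beta_prime_measure B =
        (\<integral>\<^sup>+y. ennreal c * (ennreal ((1 + (norm y)\<^sup>2) powr (- real DIM('a))) * indicator B y) \<partial>lborel)"
      unfolding beta_prime_measure_def using c by (simp add: emeasure_density ennreal_mult mult.assoc)
    then show ?thesis
      by (simp add: m_def nn_integral_cmult)
  qed
  have "prob_space (distr sphere_measure borel stereographic :: 'a measure)"
    by (intro prob_space.prob_space_distr prob_space_sphere_measure measurable_sphere_measure_borel) simp
  \<comment> \<open>Both measures have total mass 1, the first as the image of a probability measure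
    and the second by assumption. This identifies the two constants without evaluating either of
    them.\<close>
  then have "a * m UNIV = 1"
    using prob_space.emeasure_space_1 stereo[of UNIV] by force
  moreover have "ennreal c * m UNIV = 1"
    using prob_space.emeasure_space_1[OF assms] beta[of UNIV] by (simp add: beta_prime_measure_def)
  ultimately have "a = ennreal c"
    by (metis mult.assoc mult.commute mult.right_neutral)
  fix B :: "'a set"
  assume "B \<in> sets (distr sphere_measure borel stereographic)"
  then show "emeasure (distr sphere_measure borel stereographic) B = emeasure beta_prime_measure B"
    using stereo beta \<open>a = ennreal c\<close> by simp
qed simp

text \<open>Only the pole has first coordinate 1, and the cone over it lies in the line
  \<open>UNIV \<times> {0}\<close>, which is a Lebesgue null set.\<close>

lemma AE_sphere_measure_fst_less_1:
  "AE w in (sphere_measure :: (real \<times> 'a::euclidean_space) measure). fst w < 1"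
proof -
  have "emeasure lborel (cball 0 1 \<inter> sgn -` {(1 :: real, 0 :: 'a)}) \<le> emeasure lborel (UNIV \<times> {0 :: 'a} :: (real \<times> 'a) set)"
  proof (rule emeasure_mono)
    show "cball 0 1 \<inter> sgn -` {(1 :: real, 0 :: 'a)} \<subseteq> UNIV \<times> {0}"
      by (auto simp: sgn_div_norm)
    show "UNIV \<times> {0 :: 'a} \<in> sets (lborel :: (real \<times> 'a) measure)"
      by (simp add: closed_Times borel_closed)
  qed
  also have "\<dots> = 0"
    by (simp add: lborel_prod[symmetric] lborel.emeasure_pair_measure_Times)
  finally have "emeasure sphere_measure {(1 :: real, 0 :: 'a)} = 0"
    by (subst emeasure_sphere_measure) auto
  then have "{(1 :: real, 0 :: 'a)} \<in> null_sets sphere_measure"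
    by (auto simp: null_sets_def sets_sphere_measure sets_restrict_space_iff)
  then have "AE w in sphere_measure. w \<noteq> (1 :: real, 0 :: 'a)"
    using AE_not_in by force
  moreover have "AE w in (sphere_measure :: (real \<times> 'a) measure). norm w = 1"
    by (intro AE_I2) simp
  ultimately show ?thesis
  proof eventually_elim
    case (elim w)
    have "fst w \<le> 1"
      using norm_fst_le[of "fst w" "snd w"] elim(2) by simp
    moreover have "fst w \<noteq> 1"
    proof
      assume "fst w = 1"
      then have "snd w = 0"
        using elim(2) by (simp add: norm_prod_def)
      then show False
        using elim(1) \<open>fst w = 1\<close> by (metis prod.collapse)
    qed
    ultimately show ?case
      by simp
  qed
qed

text \<open>The sign of \<open>stereographic\<close> is made for this identity. The factor
  \<open>fst w - 1\<close> is negative, as \<open>facial_sets_scaleR_neg\<close> requires.\<close>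

lemma diff_north_pole_eq_scaleR_stereographic:
  assumes "norm w = 1" "fst w < 1"
  shows "w - (1, 0) = (fst w - 1) *\<^sub>R (1, stereographic w)"
proof -
  have "(fst w - 1) / (1 - fst w) = - 1"
    using assms(2) by (simp add: field_simps)
  then show ?thesis
    using assms(1) by (simp add: prod_eq_iff stereographic_def)
qed

subsection \<open>The distribution of the face vector\<close>

text \<open>The rank \<open>DIM('a) - k\<close> belongs both to spherical faces of dimension
  \<open>k\<close> in a space of dimension \<open>DIM('a) + 1\<close>, by
  \<open>num_spherical_faces_dual_cone\<close>, and to polytope faces of dimension
  \<open>DIM('a) - k - 1\<close>, by \<open>num_faces_convex_hull\<close>.\<close>

definition face_vector :: "'i set \<Rightarrow> ('i \<Rightarrow> real \<times> 'a::euclidean_space) \<Rightarrow> nat \<Rightarrow> nat" where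
  "face_vector I w = (\<lambda>k\<in>{0..<DIM('a)}. card (facial_sets I w (DIM('a) - k)))"

lemma measurable_face_vector:
  fixes w :: "'i \<Rightarrow> 's \<Rightarrow> real \<times> 'a::euclidean_space"
  assumes "finite I" "\<And>j. j \<in> I \<Longrightarrow> w j \<in> borel_measurable M"
  shows "(\<lambda>\<omega>. face_vector I (\<lambda>j. w j \<omega>)) \<in> measurable M (Pi\<^sub>M {0..<DIM('a)} (\<lambda>_. count_space UNIV))"
  unfolding face_vector_def using assms by (intro measurable_restrict measurable_card_facial_sets)

lemma measurable_PiM_sphere_measure_component:
  assumes "j \<in> I"
  shows "(\<lambda>x. x j) \<in> borel_measurable (Pi\<^sub>M I (\<lambda>_. sphere_measure))"
  using measurable_compose[OF measurable_component_singleton[OF assms, of "\<lambda>_. sphere_measure"]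
    measurable_sphere_measure_borel[OF measurable_ident]] by simp

text \<open>Here the nucleus is frozen at \<open>v\<close>. The rotation \<open>T\<close> takes it
  to the pole and keeps the law of the other points; stereographic projection then makes them
  independent beta' points, and under this coupling the two face vectors agree almost
  surely.\<close>

lemma distr_face_vector_sphere:
  fixes v :: "real \<times> 'a::euclidean_space" and T :: "real \<times> 'a \<Rightarrow> real \<times> 'a" and I :: "'i set"
  assumes I: "finite I"
    and T: "orthogonal_transformation T" "T v = (1, 0)"
    and prob: "prob_space (beta_prime_measure :: 'a measure)"
  defines "Q \<equiv> Pi\<^sub>M {0..<DIM('a)} (\<lambda>_. count_space UNIV)"
  shows "distr (Pi\<^sub>M I (\<lambda>_. sphere_measure)) Q (\<lambda>x. face_vector I (\<lambda>j. x j - v)) =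
    distr (Pi\<^sub>M I (\<lambda>_. beta_prime_measure)) Q (\<lambda>y. face_vector I (\<lambda>j. (1, y j :: 'a)))"
proof -
  let ?\<sigma> = "sphere_measure :: (real \<times> 'a) measure"
  let ?g = "stereographic \<circ> T"
  note T_meas = distr_sphere_measure_orthogonal_transformation(1)[OF T(1)]
  note T_distr = distr_sphere_measure_orthogonal_transformation(2)[OF T(1)]
  have st_meas: "stereographic \<in> measurable ?\<sigma> borel"
    by (intro measurable_sphere_measure_borel) simp
  have g_meas: "?g \<in> measurable ?\<sigma> borel"
    using T_meas st_meas by (rule measurable_comp)
  have g_distr: "distr ?\<sigma> borel ?g = beta_prime_measure"
    using distr_distr[OF st_meas T_meas] distr_sphere_measure_stereographic[OF prob] by (simp add: T_distr)
  \<comment> \<open>The rule for image measures of products speaks of target probability spaces. A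
    point mass supplies one over the Borel sets, and \<open>distr\<close> depends only on its
    sets.\<close>
  have prob_borel: "prob_space (return borel (0::'a))"
    by (intro prob_space_return) simp
  have "Pi\<^sub>M I (\<lambda>_. beta_prime_measure) = distr (Pi\<^sub>M I (\<lambda>_. ?\<sigma>)) (Pi\<^sub>M I (\<lambda>_. return borel 0)) (compose I ?g)"
    using distr_PiM_finite_prob_space'[OF I, of "\<lambda>_. ?\<sigma>" "\<lambda>_. return borel 0" ?g]
      prob_space_sphere_measure[where 'a = "real \<times> 'a"] prob_borel g_meas distr_cong[of ?\<sigma> ?\<sigma> "return borel 0" borel ?g ?g]
    by (simp add: g_distr measurable_return2)
  also have "\<dots> = distr (Pi\<^sub>M I (\<lambda>_. ?\<sigma>)) (Pi\<^sub>M I (\<lambda>_. borel)) (compose I ?g)"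
    by (intro distr_cong sets_PiM_cong) auto
  finally have Pi_beta: "Pi\<^sub>M I (\<lambda>_. beta_prime_measure) =
      distr (Pi\<^sub>M I (\<lambda>_. ?\<sigma>)) (Pi\<^sub>M I (\<lambda>_. borel)) (compose I ?g)" .
  have fv_meas: "(\<lambda>y. face_vector I (\<lambda>j. (1, y j :: 'a))) \<in> measurable (Pi\<^sub>M I (\<lambda>_. borel)) Q"
    unfolding Q_def using I by (intro measurable_face_vector) (auto simp: borel_prod[symmetric])
  have comp_meas: "compose I ?g \<in> measurable (Pi\<^sub>M I (\<lambda>_. ?\<sigma>)) (Pi\<^sub>M I (\<lambda>_. borel))"
    unfolding compose_def
    by (intro measurable_restrict measurable_compose[OF measurable_component_singleton[where M = "\<lambda>_. ?\<sigma>"] g_meas])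
  have diff_meas: "(\<lambda>x. face_vector I (\<lambda>j. x j - v)) \<in> measurable (Pi\<^sub>M I (\<lambda>_. ?\<sigma>)) Q"
    unfolding Q_def using I
    by (intro measurable_face_vector borel_measurable_diff measurable_PiM_sphere_measure_component) auto
  have "distr (Pi\<^sub>M I (\<lambda>_. beta_prime_measure)) Q (\<lambda>y. face_vector I (\<lambda>j. (1, y j :: 'a))) =
      distr (Pi\<^sub>M I (\<lambda>_. ?\<sigma>)) Q ((\<lambda>y. face_vector I (\<lambda>j. (1, y j))) \<circ> compose I ?g)"
    unfolding Pi_beta by (rule distr_distr[OF fv_meas comp_meas])
  also have "\<dots> = distr (Pi\<^sub>M I (\<lambda>_. ?\<sigma>)) Q (\<lambda>x. face_vector I (\<lambda>j. x j - v))"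
  proof (rule distr_cong_AE)
    \<comment> \<open>By rotation invariance \<open>T w\<close> has the law of \<open>w\<close>, so
      it avoids the pole almost surely.\<close>
    have "AE w in distr ?\<sigma> ?\<sigma> T. fst w < 1"
      using AE_sphere_measure_fst_less_1 by (simp only: T_distr)
    then have "AE w in ?\<sigma>. fst (T w) < 1"
      by (rule AE_distrD[OF T_meas])
    then have "AE x in Pi\<^sub>M I (\<lambda>_. ?\<sigma>). \<forall>j\<in>I. fst (T (x j)) < 1"
      using I by (intro AE_finite_allI AE_PiM_component prob_space_sphere_measure) auto
    moreover have "AE x in Pi\<^sub>M I (\<lambda>_. ?\<sigma>). \<forall>j\<in>I. norm (x j) = 1"
      by (intro AE_I2) (auto simp: space_PiM PiE_iff)
    ultimately show "AE x in Pi\<^sub>M I (\<lambda>_. ?\<sigma>). ((\<lambda>y. face_vector I (\<lambda>j. (1, y j))) \<circ> compose I ?g) x =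
        face_vector I (\<lambda>j. x j - v)"
    proof eventually_elim
      case (elim x)
      have "facial_sets I (\<lambda>j. x j - v) r = facial_sets I (\<lambda>j. (1 :: real, compose I ?g x j)) r" for r
      proof -
        have "facial_sets I (\<lambda>j. x j - v) r = facial_sets I (\<lambda>j. T (x j - v)) r"
          by (rule facial_sets_orthogonal_transformation[OF T(1), symmetric])
        also have "\<dots> = facial_sets I (\<lambda>j. (fst (T (x j)) - 1) *\<^sub>R (1 :: real, compose I ?g x j)) r"
        proof (rule facial_sets_cong)
          fix j assume j: "j \<in> I"
          have "T (x j - v) = T (x j) - (1, 0)"
            using linear_diff[OF orthogonal_transformation_linear[OF T(1)]] T(2) by simp
          also have "\<dots> = (fst (T (x j)) - 1) *\<^sub>R (1, stereographic (T (x j)))"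
            using elim j orthogonal_transformation_norm[OF T(1)]
            by (intro diff_north_pole_eq_scaleR_stereographic) auto
          finally show "T (x j - v) = (fst (T (x j)) - 1) *\<^sub>R (1 :: real, compose I ?g x j)"
            using j by (simp add: compose_def)
        qed
        also have "\<dots> = facial_sets I (\<lambda>j. (1 :: real, compose I ?g x j)) r"
          using elim by (intro facial_sets_scaleR_neg) auto
        finally show ?thesis .
      qed
      then show ?case
        by (simp add: face_vector_def)
    qed
  qed (use measurable_comp[OF comp_meas fv_meas] diff_meas in auto)
  finally show ?thesis
    by simp
qed

text \<open>Relabelling independent, identically distributed points does not alter their joint law,
  and face counts do not depend on labels. This replaces the index set without the nucleus by
  \<open>{1..n}\<close>.\<close>

lemma distr_face_vector_reindex:
  fixes I :: "'i set" and K :: "'k set"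
  assumes "finite I" "bij_betw f I K"
    and prob: "prob_space (beta_prime_measure :: 'a::euclidean_space measure)"
  defines "Q \<equiv> Pi\<^sub>M {0..<DIM('a)} (\<lambda>_. count_space UNIV)"
  shows "distr (Pi\<^sub>M I (\<lambda>_. beta_prime_measure)) Q (\<lambda>y. face_vector I (\<lambda>j. (1, y j :: 'a))) =
    distr (Pi\<^sub>M K (\<lambda>_. beta_prime_measure)) Q (\<lambda>y. face_vector K (\<lambda>j. (1, y j :: 'a)))"
proof -
  let ?\<mu> = "beta_prime_measure :: 'a measure"
  have f: "inj_on f I" "f \<in> I \<rightarrow> K"
    using assms(2) by (auto simp: bij_betw_def)
  have fv_meas: "(\<lambda>y. face_vector I (\<lambda>j. (1, y j :: 'a))) \<in> measurable (Pi\<^sub>M I (\<lambda>_. ?\<mu>)) Q"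
    unfolding Q_def using assms(1) by (intro measurable_face_vector) (auto simp: borel_prod[symmetric])
  have f_meas: "(\<lambda>y. \<lambda>n\<in>I. y (f n)) \<in> measurable (Pi\<^sub>M K (\<lambda>_. ?\<mu>)) (Pi\<^sub>M I (\<lambda>_. ?\<mu>))"
    using f(2) by (intro measurable_restrict measurable_component_singleton) auto
  have "distr (Pi\<^sub>M I (\<lambda>_. ?\<mu>)) Q (\<lambda>y. face_vector I (\<lambda>j. (1, y j :: 'a))) =
      distr (Pi\<^sub>M K (\<lambda>_. ?\<mu>)) Q ((\<lambda>y. face_vector I (\<lambda>j. (1, y j))) \<circ> (\<lambda>y. \<lambda>n\<in>I. y (f n)))"
    using distr_distr[OF fv_meas f_meas] distr_PiM_reindex[of K "\<lambda>_. ?\<mu>" f I] f prob by simp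
  also have "(\<lambda>y. face_vector I (\<lambda>j. (1, y j))) \<circ> (\<lambda>y. \<lambda>n\<in>I. y (f n)) =
      (\<lambda>y. face_vector K (\<lambda>j. (1, y j :: 'a)))"
  proof
    fix y :: "'k \<Rightarrow> 'a"
    have "facial_sets I (\<lambda>j. (1::real, (\<lambda>n\<in>I. y (f n)) j)) r = facial_sets I (\<lambda>j. (1::real, y (f j))) r" for r
      by (rule facial_sets_cong) simp
    then show "((\<lambda>y. face_vector I (\<lambda>j. (1, y j))) \<circ> (\<lambda>y. \<lambda>n\<in>I. y (f n))) y = face_vector K (\<lambda>j. (1, y j))"
      using card_facial_sets_reindex[OF assms(2), of "\<lambda>j. (1::real, y j)"]
      by (simp add: face_vector_def)
  qed
  finally show ?thesis .
qed

text \<open>By Fubini the coordinate \<open>i\<close> is integrated last. For each of its values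
  \<open>v\<close> the inner law is that of the beta' face vector, so the outer integrand is
  constant.\<close>

lemma distr_face_vector_diff:
  fixes I :: "'i set"
  assumes I: "finite I" "i \<in> I"
    and T: "\<And>v :: real \<times> 'a::euclidean_space. norm v = 1 \<Longrightarrow>
      \<exists>T :: real \<times> 'a \<Rightarrow> real \<times> 'a. orthogonal_transformation T \<and> T v = (1, 0)"
    and prob: "prob_space (beta_prime_measure :: 'a measure)"
  defines "Q \<equiv> Pi\<^sub>M {0..<DIM('a)} (\<lambda>_. count_space UNIV)"
  shows "distr (Pi\<^sub>M I (\<lambda>_. sphere_measure :: (real \<times> 'a) measure)) Q
      (\<lambda>x. face_vector (I - {i}) (\<lambda>j. x j - x i)) =
    distr (Pi\<^sub>M (I - {i}) (\<lambda>_. beta_prime_measure)) Q (\<lambda>y. face_vector (I - {i}) (\<lambda>j. (1, y j :: 'a)))"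
    (is "?L = ?R")
proof (rule measure_eqI)
  let ?\<sigma> = "sphere_measure :: (real \<times> 'a) measure"
  let ?J = "I - {i}"
  interpret \<sigma>: prob_space ?\<sigma>
    by (rule prob_space_sphere_measure)
  interpret product_sigma_finite "\<lambda>_::'i. ?\<sigma>" ..
  have ins: "insert i ?J = I"
    using I by auto
  have meas: "(\<lambda>x. face_vector ?J (\<lambda>j. x j - x i)) \<in> measurable (Pi\<^sub>M I (\<lambda>_. ?\<sigma>)) Q"
    unfolding Q_def using I
    by (intro measurable_face_vector borel_measurable_diff measurable_PiM_sphere_measure_component) auto
  fix A assume "A \<in> sets ?L"
  then have A [measurable]: "A \<in> sets Q"
    by simp
  have ind: "(\<lambda>x. indicator A (face_vector ?J (\<lambda>j. x j - x i)) :: ennreal) \<in> borel_measurable (Pi\<^sub>M I (\<lambda>_. ?\<sigma>))"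
    using meas A by (intro borel_measurable_indicator' measurable_sets) auto
  have "emeasure ?L A = (\<integral>\<^sup>+x. indicator A (face_vector ?J (\<lambda>j. x j - x i)) \<partial>Pi\<^sub>M I (\<lambda>_. ?\<sigma>))"
    using meas by (simp add: nn_integral_distr flip: nn_integral_indicator)
  also have "\<dots> = (\<integral>\<^sup>+v. \<integral>\<^sup>+x. indicator A (face_vector ?J (\<lambda>j. (x(i := v)) j - (x(i := v)) i)) \<partial>Pi\<^sub>M ?J (\<lambda>_. ?\<sigma>) \<partial>?\<sigma>)"
    by (rule product_nn_integral_insert_rev[of ?J i "\<lambda>x. indicator A (face_vector ?J (\<lambda>j. x j - x i))", unfolded ins])
      (use I ind in auto)
  also have "\<dots> = (\<integral>\<^sup>+v. emeasure ?R A \<partial>?\<sigma>)"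
  proof (rule nn_integral_cong)
    fix v :: "real \<times> 'a"
    assume "v \<in> space ?\<sigma>"
    then obtain S :: "real \<times> 'a \<Rightarrow> real \<times> 'a" where S: "orthogonal_transformation S" "S v = (1, 0)"
      using T[of v] by auto
    have meas_v: "(\<lambda>x. face_vector ?J (\<lambda>j. x j - v)) \<in> measurable (Pi\<^sub>M ?J (\<lambda>_. ?\<sigma>)) Q"
      unfolding Q_def using I
      by (intro measurable_face_vector borel_measurable_diff measurable_PiM_sphere_measure_component) auto
    have "face_vector ?J (\<lambda>j. (x(i := v)) j - (x(i := v)) i) = face_vector ?J (\<lambda>j. x j - v)"
      for x :: "'i \<Rightarrow> real \<times> 'a"
    proof -
      have "facial_sets ?J (\<lambda>j. (x(i := v)) j - (x(i := v)) i) r = facial_sets ?J (\<lambda>j. x j - v) r" for r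
        by (rule facial_sets_cong) simp
      then show ?thesis
        by (simp add: face_vector_def)
    qed
    then have "(\<integral>\<^sup>+x. indicator A (face_vector ?J (\<lambda>j. (x(i := v)) j - (x(i := v)) i)) \<partial>Pi\<^sub>M ?J (\<lambda>_. ?\<sigma>)) =
        (\<integral>\<^sup>+x. indicator A (face_vector ?J (\<lambda>j. x j - v)) \<partial>Pi\<^sub>M ?J (\<lambda>_. ?\<sigma>))"
      by simp
    also have "\<dots> = emeasure (distr (Pi\<^sub>M ?J (\<lambda>_. ?\<sigma>)) Q (\<lambda>x. face_vector ?J (\<lambda>j. x j - v))) A"
      using meas_v by (simp add: nn_integral_distr flip: nn_integral_indicator)
    also have "\<dots> = emeasure ?R A"
      unfolding Q_def using distr_face_vector_sphere[OF _ S prob, of ?J] I by simp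
    finally show "(\<integral>\<^sup>+x. indicator A (face_vector ?J (\<lambda>j. (x(i := v)) j - (x(i := v)) i)) \<partial>Pi\<^sub>M ?J (\<lambda>_. ?\<sigma>)) =
        emeasure ?R A" .
  qed
  also have "\<dots> = emeasure ?R A"
    using \<sigma>.emeasure_space_1 by simp
  finally show "emeasure ?L A = emeasure ?R A" .
qed simp

section \<open>Voronoi cells as dual cones\<close>

lemma voronoi_cell_eq_dual_cone:
  assumes "\<And>j. j \<in> {1..m} \<Longrightarrow> norm (x j) = 1" "i \<in> {1..m}"
  shows "voronoi_cell m x i = dual_cone ({1..m} - {i}) (\<lambda>j. x j - x i) \<inter> sphere 0 1"
proof -
  have "geodesic_dist (x i) z \<le> geodesic_dist (x j) z \<longleftrightarrow> (x j - x i) \<bullet> z \<le> 0"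
    if "norm z = 1" "j \<in> {1..m}" for z j
    using Cauchy_Schwarz_ineq2[of "x i" z] Cauchy_Schwarz_ineq2[of "x j" z] assms that
    by (simp add: geodesic_dist_def arccos_le_mono inner_diff_left)
  then show ?thesis
    using assms(2) by (fastforce simp: voronoi_cell_def dual_cone_def)
qed

lemma orthogonal_transformation_image_dual_cone:
  fixes T :: "'a::euclidean_space \<Rightarrow> 'a"
  assumes T: "orthogonal_transformation T"
  shows "T ` (dual_cone I w \<inter> sphere 0 1) = dual_cone I (\<lambda>j. T (w j)) \<inter> sphere 0 1"
proof (intro equalityI subsetI)
  have inner: "T a \<bullet> T b = a \<bullet> b" for a b
    using T by (simp add: orthogonal_transformation_def)
  fix y
  show "y \<in> dual_cone I (\<lambda>j. T (w j)) \<inter> sphere 0 1" if "y \<in> T ` (dual_cone I w \<inter> sphere 0 1)"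
    using that orthogonal_transformation_norm[OF T] by (auto simp: dual_cone_def inner)
  assume y: "y \<in> dual_cone I (\<lambda>j. T (w j)) \<inter> sphere 0 1"
  obtain z where z: "y = T z"
    using surjD[OF orthogonal_transformation_surj[OF T]] by blast
  then show "y \<in> T ` (dual_cone I w \<inter> sphere 0 1)"
    using y orthogonal_transformation_norm[OF T] by (auto simp: dual_cone_def inner)
qed

text \<open>A rotation moves the cone but keeps its facial sets, so the count can be written without
  \<open>R\<close>.\<close>

lemma num_spherical_faces_typical_cell:
  fixes x :: "nat \<Rightarrow> 'a::euclidean_space"
  assumes "\<And>j. j \<in> {1..m} \<Longrightarrow> norm (x j) = 1" "i \<in> {1..m}"
    and "orthogonal_transformation (R (x i))" "k < DIM('a)"
  shows "num_spherical_faces k (typical_cell m R x i) =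
    card (facial_sets ({1..m} - {i}) (\<lambda>j. x j - x i) (DIM('a) - (k + 1)))"
proof -
  have cell: "voronoi_cell m x i = dual_cone ({1..m} - {i}) (\<lambda>j. x j - x i) \<inter> sphere 0 1"
    using assms(1,2) by (rule voronoi_cell_eq_dual_cone)
  show ?thesis
    unfolding typical_cell_def cell orthogonal_transformation_image_dual_cone[OF assms(3)]
    using assms(4)
    by (simp add: num_spherical_faces_dual_cone facial_sets_orthogonal_transformation[OF assms(3)])
qed

theorem theorem2p3:
  fixes n :: nat
    and M :: "'s measure"
    and X :: "nat \<Rightarrow> 's \<Rightarrow> real \<times> (real ^ 'd)"
    and N :: "'s \<Rightarrow> nat"
    and R :: "real \<times> (real ^ 'd) \<Rightarrow> real \<times> (real ^ 'd) \<Rightarrow> real \<times> (real ^ 'd)"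
    and M' :: "'t measure"
    and Y :: "nat \<Rightarrow> 't \<Rightarrow> real ^ 'd"
  assumes n: "n \<ge> CARD('d) + 1"
    and R_orthogonal: "\<And>v. v \<in> sphere 0 1 \<Longrightarrow> orthogonal_transformation (R v)"
    and R_north: "\<And>v. v \<in> sphere 0 1 \<Longrightarrow> R v v = (1, 0)"
    and R_borel: "\<And>b c. b \<in> Basis \<Longrightarrow> c \<in> Basis \<Longrightarrow>
      (\<lambda>v. R v b \<bullet> c) \<in> borel_measurable (restrict_space borel (sphere 0 1))"
    and M: "prob_space M"
    and X_indep: "prob_space.indep_vars M (\<lambda>_. sphere_measure) X {1..n + 1}"
    and X_distr: "\<And>i. i \<in> {1..n + 1} \<Longrightarrow> distr M sphere_measure (X i) = sphere_measure"
    and N_measurable: "N \<in> measurable M (count_space {1..n + 1})"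
    and N_distr: "distr M (count_space {1..n + 1}) N = uniform_count_measure {1..n + 1}"
    and N_X_indep: "prob_space.indep_set M
      (sets (vimage_algebra (space M) N (count_space {1..n + 1})))
      (sets (vimage_algebra (space M) (\<lambda>\<omega>. \<lambda>i\<in>{1..n + 1}. X i \<omega>)
        (Pi\<^sub>M {1..n + 1} (\<lambda>_. sphere_measure))))"
    and M': "prob_space M'"
    and Y_indep: "prob_space.indep_vars M' (\<lambda>_. borel) Y {1..n}"
    and Y_distr: "\<And>i. i \<in> {1..n} \<Longrightarrow>
      distributed M' lborel (Y i) (\<lambda>x. ennreal (beta_prime_density (real CARD('d)) x))"
  shows "eq_in_distribution
    M (\<lambda>\<omega>. \<lambda>k\<in>{0..<CARD('d)}.
      num_spherical_faces k (typical_cell (n + 1) R (\<lambda>i. X i \<omega>) (N \<omega>)))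
    M' (\<lambda>\<omega>. \<lambda>k\<in>{0..<CARD('d)}.
      num_faces (CARD('d) - k - 1) (beta_prime_polytope n (\<lambda>i. Y i \<omega>)))
    (Pi\<^sub>M {0..<CARD('d)} (\<lambda>_. count_space (UNIV :: nat set)))"
proof -
  let ?I = "{1..n + 1}" and ?\<sigma> = "sphere_measure :: (real \<times> (real ^ 'd)) measure"
  let ?d = "CARD('d)" and ?\<mu> = "beta_prime_measure :: (real ^ 'd) measure"
  let ?Q = "Pi\<^sub>M {0..<CARD('d)} (\<lambda>_. count_space (UNIV :: nat set))"
  let ?PX = "Pi\<^sub>M ?I (\<lambda>_. ?\<sigma>)" and ?PY = "Pi\<^sub>M {1..n} (\<lambda>_. ?\<mu>)"
  interpret M: prob_space M by fact
  interpret M': prob_space M' by fact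
  have Y_meas: "Y i \<in> measurable M' borel" and Y_law: "distr M' borel (Y i) = ?\<mu>"
    if "i \<in> {1..n}" for i
  proof -
    show meas: "Y i \<in> measurable M' borel"
      using distributed_measurable[OF Y_distr[OF that]] by simp
    have "distr M' borel (Y i) = distr M' lborel (Y i)"
      by (rule distr_cong) auto
    then show "distr M' borel (Y i) = ?\<mu>"
      using distributed_distr_eq_density[OF Y_distr[OF that]] by (simp add: beta_prime_measure_def)
  qed
  \<comment> \<open>There is at least one point \<open>Y i\<close>, and its law shows that the beta'
    density has total mass 1.\<close>
  have "1 \<in> {1..n}"
    using n by simp
  then have prob_\<mu>: "prob_space ?\<mu>"
    using M'.prob_space_distr Y_meas Y_law by metis
  let ?F = "\<lambda>y. face_vector {1..n} (\<lambda>j. (1 :: real, y j :: real ^ 'd))"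
  define L where "L = distr ?PY ?Q ?F"
  have F_meas: "?F \<in> measurable ?PY ?Q"
    using measurable_face_vector[of "{1..n}" "\<lambda>j y. (1, y j)" ?PY]
    by (simp add: borel_prod[symmetric])

  \<comment> \<open>The face vector of the beta' polytope\<close>
  let ?Yt = "\<lambda>\<omega>. \<lambda>i\<in>{1..n}. Y i \<omega>"
  have Yt_law: "distr M' ?PY ?Yt = ?PY"
  proof -
    have "distr M' (Pi\<^sub>M {1..n} (\<lambda>_. borel)) ?Yt = Pi\<^sub>M {1..n} (\<lambda>i. distr M' borel (Y i))"
      using M'.indep_vars_iff_distr_eq_PiM'[where I = "{1..n}" and M' = "\<lambda>_. borel" and X = Y] Y_indep Y_meas \<open>1 \<in> {1..n}\<close> by blast
    also have "\<dots> = ?PY"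
      using Y_law by (intro PiM_cong) auto
    also have "distr M' (Pi\<^sub>M {1..n} (\<lambda>_. borel)) ?Yt = distr M' ?PY ?Yt"
      by (intro distr_cong sets_PiM_cong) auto
    finally show ?thesis .
  qed
  have Yt_meas: "?Yt \<in> measurable M' ?PY"
    using Y_meas by (intro measurable_restrict) (simp add: measurable_cong_sets[OF refl sets_beta_prime_measure])
  \<comment> \<open>A face of dimension \<open>?d - k - 1\<close> corresponds to rank
    \<open>?d - k\<close>; the subtraction does not truncate since \<open>k < ?d\<close>.\<close>
  have polytope: "(\<lambda>k\<in>{0..<?d}. num_faces (?d - k - 1) (beta_prime_polytope n (\<lambda>i. Y i \<omega>))) = ?F (?Yt \<omega>)" for \<omega>
  proof -
    have "facial_sets {1..n} (\<lambda>j. (1 :: real, ?Yt \<omega> j)) r = facial_sets {1..n} (\<lambda>j. (1 :: real, Y j \<omega>)) r" for r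
      by (rule facial_sets_cong) simp
    then show ?thesis
      by (auto simp: face_vector_def beta_prime_polytope_def num_faces_convex_hull Suc_diff_Suc fun_eq_iff restrict_def)
  qed

  \<comment> \<open>The face vector of the cell of a fixed nucleus\<close>
  have X_meas: "X i \<in> measurable M ?\<sigma>" if "i \<in> ?I" for i
    using X_indep that by (simp add: M.indep_vars_def)
  let ?Xt = "\<lambda>\<omega>. \<lambda>i\<in>?I. X i \<omega>"
  have Xt_meas: "?Xt \<in> measurable M ?PX"
    using X_meas by (intro measurable_restrict)
  have Xt_law: "distr M ?PX ?Xt = ?PX"
  proof -
    have "distr M ?PX ?Xt = Pi\<^sub>M ?I (\<lambda>i. distr M ?\<sigma> (X i))"
      using M.indep_vars_iff_distr_eq_PiM'[where I = ?I and M' = "\<lambda>_. ?\<sigma>" and X = X] X_indep X_meas by auto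
    also have "\<dots> = ?PX"
      using X_distr by (intro PiM_cong) auto
    finally show ?thesis .
  qed
  let ?G = "\<lambda>i x. face_vector (?I - {i}) (\<lambda>j. x j - x i :: real \<times> (real ^ 'd))"
  have G_meas: "?G i \<in> measurable ?PX ?Q" if "i \<in> ?I" for i
    using measurable_face_vector[of "?I - {i}" "\<lambda>j x. x j - x i" ?PX] that
    by (simp add: borel_measurable_diff measurable_PiM_sphere_measure_component)
  have G_law: "distr M ?Q (\<lambda>\<omega>. ?G i (?Xt \<omega>)) = L" if i: "i \<in> ?I" for i
  proof -
    \<comment> \<open>Removing the nucleus from \<open>n + 1\<close> points leaves \<open>n\<close>,
      the number of points that span the polytope.\<close>
    obtain f where f: "bij_betw f (?I - {i}) {1..n}"
      using finite_same_card_bij[of "?I - {i}" "{1..n}"] i by auto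
    have "distr M ?Q (\<lambda>\<omega>. ?G i (?Xt \<omega>)) = distr ?PX ?Q (?G i)"
      using distr_distr[OF G_meas[OF i] Xt_meas, symmetric] by (simp only: Xt_law o_def)
    also have "\<dots> = distr (Pi\<^sub>M (?I - {i}) (\<lambda>_. ?\<mu>)) ?Q (\<lambda>y. face_vector (?I - {i}) (\<lambda>j. (1, y j)))"
      \<comment> \<open>The rotation that takes \<open>v\<close> to the pole is
        \<open>R v\<close>.\<close>
      using distr_face_vector_diff[OF _ i _ prob_\<mu>] R_orthogonal R_north by fastforce
    also have "\<dots> = L"
      unfolding L_def using distr_face_vector_reindex[OF _ f prob_\<mu>] by simp
    finally show ?thesis .
  qed
  have N_in: "N \<omega> \<in> ?I" if "\<omega> \<in> space M" for \<omega>
    using measurable_space[OF N_measurable that] by simp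
  \<comment> \<open>The cone lives in dimension \<open>?d + 1\<close>, so the rank is
    \<open>?d + 1 - (k + 1) = ?d - k\<close>.\<close>
  have cell: "(\<lambda>k\<in>{0..<?d}. num_spherical_faces k (typical_cell (n + 1) R (\<lambda>i. X i \<omega>) (N \<omega>))) =
      ?G (N \<omega>) (?Xt \<omega>)" if \<omega>: "\<omega> \<in> space M" for \<omega>
  proof -
    have norm: "norm (X j \<omega>) = 1" if "j \<in> ?I" for j
      using measurable_space[OF X_meas[OF that] \<omega>] by simp
    have "facial_sets (?I - {N \<omega>}) (\<lambda>j. ?Xt \<omega> j - ?Xt \<omega> (N \<omega>)) r =
        facial_sets (?I - {N \<omega>}) (\<lambda>j. X j \<omega> - X (N \<omega>) \<omega>) r" for r
      using N_in[OF \<omega>] by (intro facial_sets_cong) simp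
    moreover have "num_spherical_faces k (typical_cell (n + 1) R (\<lambda>i. X i \<omega>) (N \<omega>)) =
        card (facial_sets (?I - {N \<omega>}) (\<lambda>j. X j \<omega> - X (N \<omega>) \<omega>) (?d - k))" if "k < ?d" for k
    proof -
      have "num_spherical_faces k (typical_cell (n + 1) R (\<lambda>i. X i \<omega>) (N \<omega>)) =
          card (facial_sets (?I - {N \<omega>}) (\<lambda>j. X j \<omega> - X (N \<omega>) \<omega>) (DIM(real \<times> (real ^ 'd)) - (k + 1)))"
        by (rule num_spherical_faces_typical_cell)
          (use norm N_in[OF \<omega>] R_orthogonal that in auto)
      then show ?thesis
        by simp
    qed
    ultimately show ?thesis
      by (auto simp: face_vector_def fun_eq_iff restrict_def)
  qed

  \<comment> \<open>Averaging over the random nucleus\<close>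
  have Z_meas: "(\<lambda>\<omega>. ?G (N \<omega>) (?Xt \<omega>)) \<in> measurable M ?Q"
    by (rule measurable_compose_countable'[OF _ N_measurable])
      (use measurable_compose[OF Xt_meas G_meas] in auto)
  have Z_law: "distr M ?Q (\<lambda>\<omega>. ?G (N \<omega>) (?Xt \<omega>)) = L"
  proof (rule measure_eqI)
    fix A assume "A \<in> sets (distr M ?Q (\<lambda>\<omega>. ?G (N \<omega>) (?Xt \<omega>)))"
    then have A: "A \<in> sets ?Q"
      by simp
    define a where "a i = N -` {i} \<inter> space M" for i
    define b where "b i = (\<lambda>\<omega>. ?G i (?Xt \<omega>)) -` A \<inter> space M" for i
    have ab_sets: "a i \<in> sets M" "b i \<in> sets M" if "i \<in> ?I" for i
      using measurable_sets[OF N_measurable, of "{i}"] that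
        measurable_sets[OF measurable_compose[OF Xt_meas G_meas[OF that]] A]
      by (simp_all add: a_def b_def)
    \<comment> \<open>\<open>a i\<close> depends on \<open>N\<close> alone and \<open>b i\<close> on
      the points alone, so the independence of \<open>N\<close> from the points applies.\<close>
    have indep: "M.prob (a i \<inter> b i) = M.prob (a i) * M.prob (b i)" if i: "i \<in> ?I" for i
    proof (rule M.indep_setD[OF N_X_indep])
      show "a i \<in> sets (vimage_algebra (space M) N (count_space ?I))"
        unfolding a_def using i by (intro in_vimage_algebra) auto
      have b: "b i = ?Xt -` (?G i -` A \<inter> space ?PX) \<inter> space M"
        using measurable_space[OF Xt_meas] by (auto simp: b_def)
      show "b i \<in> sets (vimage_algebra (space M) ?Xt ?PX)"
        unfolding b by (rule in_vimage_algebra[OF measurable_sets[OF G_meas[OF i] A]])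
    qed
    have a_prob: "M.prob (a i) = 1 / (n + 1)" if i: "i \<in> ?I" for i
    proof -
      have "emeasure M (a i) = emeasure (distr M (count_space ?I) N) {i}"
        using i by (subst emeasure_distr[OF N_measurable]) (auto simp: a_def)
      also have "\<dots> = ennreal (1 / (n + 1))"
        using i unfolding N_distr by (subst emeasure_uniform_count_measure) auto
      finally show ?thesis
        by (simp add: M.emeasure_eq_measure)
    qed
    interpret L: prob_space L
      unfolding L_def using F_meas prob_\<mu> by (intro prob_space.prob_space_distr prob_space_PiM)
    have b_prob: "M.prob (b i) = L.prob A" if i: "i \<in> ?I" for i
    proof -
      have "emeasure L A = emeasure M (b i)"
        unfolding G_law[OF i, symmetric] b_def
        by (rule emeasure_distr[OF measurable_compose[OF Xt_meas G_meas[OF i]] A])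
      then show ?thesis
        by (simp add: M.emeasure_eq_measure L.emeasure_eq_measure)
    qed
    \<comment> \<open>The event is split by the value of \<open>N\<close>; each of the
      \<open>n + 1\<close> parts has probability \<open>1 / (n + 1)\<close> times the common value
      \<open>L.prob A\<close>.\<close>
    have "(\<lambda>\<omega>. ?G (N \<omega>) (?Xt \<omega>)) -` A \<inter> space M = (\<Union>i\<in>?I. a i \<inter> b i)"
      using N_in unfolding a_def b_def by blast
    then have "emeasure (distr M ?Q (\<lambda>\<omega>. ?G (N \<omega>) (?Xt \<omega>))) A = M.prob (\<Union>i\<in>?I. a i \<inter> b i)"
      by (subst emeasure_distr[OF Z_meas A]) (simp add: M.emeasure_eq_measure)
    also have "M.prob (\<Union>i\<in>?I. a i \<inter> b i) = (\<Sum>i\<in>?I. M.prob (a i \<inter> b i))"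
      using ab_sets by (intro M.finite_measure_finite_Union) (auto simp: disjoint_family_on_def a_def)
    also have "\<dots> = (\<Sum>i\<in>?I. 1 / (n + 1) * L.prob A)"
      by (intro sum.cong refl) (simp only: indep a_prob b_prob)
    also have "\<dots> = L.prob A"
      by simp
    finally show "emeasure (distr M ?Q (\<lambda>\<omega>. ?G (N \<omega>) (?Xt \<omega>))) A = emeasure L A"
      by (simp add: L.emeasure_eq_measure)
  qed (simp add: L_def)

  show ?thesis
    unfolding eq_in_distribution_def polytope
  proof (intro conjI)
    show "(\<lambda>\<omega>. \<lambda>k\<in>{0..<?d}. num_spherical_faces k (typical_cell (n + 1) R (\<lambda>i. X i \<omega>) (N \<omega>))) \<in> measurable M ?Q"
      using Z_meas cell by (subst measurable_cong)
    show "(\<lambda>\<omega>. ?F (?Yt \<omega>)) \<in> measurable M' ?Q"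
      by (rule measurable_compose[OF Yt_meas F_meas])
    have "distr M' ?Q (\<lambda>\<omega>. ?F (?Yt \<omega>)) = L"
      using distr_distr[OF F_meas Yt_meas, symmetric] by (simp only: Yt_law L_def o_def)
    moreover have "distr M ?Q (\<lambda>\<omega>. \<lambda>k\<in>{0..<?d}. num_spherical_faces k (typical_cell (n + 1) R (\<lambda>i. X i \<omega>) (N \<omega>))) = L"
      unfolding Z_law[symmetric] using cell by (intro distr_cong) auto
    ultimately show "distr M ?Q (\<lambda>\<omega>. \<lambda>k\<in>{0..<?d}. num_spherical_faces k (typical_cell (n + 1) R (\<lambda>i. X i \<omega>) (N \<omega>))) =
        distr M' ?Q (\<lambda>\<omega>. ?F (?Yt \<omega>))"
      by simp
  qed
qed

end
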